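(* Let $\lambda>0$, let $A$ be a positive, injective self-adjoint operator on a Hilbert space $\mathbb H$, and let $f\in D(A)$. Let $U:\mathbb H\to L^2(\Omega,\Sigma,\mu)$ be unitary and $m:\Omega\to(0,\infty)$ measurable with $UAU^{-1}$ equal to multiplication by $m$, and write $\widehat f=Uf$. Let $u(t)=U^{-1}\widehat u(t)$ be the unique solution of the abstract Euler-Poisson-Darboux problem $$\Big[\partial_t^2+\frac{2\lambda}{t}\partial_t+A\Big]u=0,\quad t>0,\qquad u(0)=f,\quad \partial_tu(0)=0.$$ Then, for $t>0$, $\widehat u$ has the representations $$\widehat u(t,\xi)=\Big(\frac{2}{t\sqrt{m(\xi)}}\Big)^{\lambda-\frac12}\Gamma\big(\lambda+\tfrac12\big)J_{\lambda-\frac12}\big(t\sqrt{m(\xi)}\big)\widehat f(\xi)$$ $$=\frac{\widehat f(\xi)}{B(\lambda,\frac12)\,t}\int_{-t}^{t}\Big(1-\frac{w^2}{t^2}\Big)^{\lambda-1}\,\frac{e^{i\sqrt{m(\xi)}w}+e^{-i\sqrt{m(\xi)}w}}{2}\,dw =\frac{1}{B(\lambda,\frac12)\,t}\int_{-t}^{t}\Big(1-\frac{w^2}{t^2}\Big)^{\lambda-1}\widehat{\bar u}(w,\xi)\,dw,$$ where $\bar u$ is the unique solution of the abstract wave equation $(\partial_t^2+A)\bar u=0$ with initial conditions $\bar u(0)=f$, $\partial_t\bar u(0)=0$, and $\widehat{\bar u}(w,\cdot)=U\bar u(w)$. Furthermore, the unique solution to the Euler-Poisson-Darboux Cauchy problem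 is given by $$u(t)=\mathbb E\big[\bar u(t\sqrt{\mathfrak X})\big],$$ where $\mathfrak X$ is a Beta random variable with parameters $\frac12$ and $\lambda$.
   Context: $J_\nu$ is the Bessel function of the first kind and $B(\cdot,\cdot)$ the Euler Beta function. A Beta random variable with parameters $a,b$ has density $x^{a-1}(1-x)^{b-1}/B(a,b)$ on $(0,1)$. The existence of $U$ and $m$ is the multiplication form of the spectral theorem. The function $\widehat u(\cdot,\xi)$ solves, for $\mu$-a.e. $\xi$, the scalar problem $\partial_t^2\widehat u+\frac{2\lambda}{t}\partial_t\widehat u+m(\xi)\widehat u=0$, $\widehat u(0,\xi)=\widehat f(\xi)$, $\partial_t\widehat u(0,\xi)=0$. The wave solution $\bar u$ is considered for all real times ($\bar u(-t)=\bar u(t)$). The expectation is an $\mathbb H$-valued (Bochner) expectation. *)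

theory Defs
  imports "HOL-Probability.Probability"
begin

text \<open>
  Complex Hilbert spaces. The inner product is linear in the first argument. Separability is not
  assumed.
\<close>

class complex_hilbert_space = banach +
  fixes scaleC :: "complex \<Rightarrow> 'a \<Rightarrow> 'a" (infixr "*\<^sub>C" 75)
    and cinner :: "'a \<Rightarrow> 'a \<Rightarrow> complex"
  assumes scaleC_add_right: "c *\<^sub>C (x + y) = c *\<^sub>C x + c *\<^sub>C y"
    and scaleC_add_left: "(c + d) *\<^sub>C x = c *\<^sub>C x + d *\<^sub>C x"
    and scaleC_scaleC: "c *\<^sub>C d *\<^sub>C x = (c * d) *\<^sub>C x"
    and scaleC_of_real: "complex_of_real r *\<^sub>C x = r *\<^sub>R x"
    and cinner_commute: "cinner x y = cnj (cinner y x)"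
    and cinner_add_left: "cinner (x + y) z = cinner x z + cinner y z"
    and cinner_scaleC_left: "cinner (c *\<^sub>C x) y = c * cinner x y"
    and norm_eq_sqrt_cinner: "norm x = sqrt (Re (cinner x x))"

instantiation complex :: complex_hilbert_space
begin

definition scaleC_complex :: "complex \<Rightarrow> complex \<Rightarrow> complex"
  where "scaleC_complex c z = c * z"

definition cinner_complex :: "complex \<Rightarrow> complex \<Rightarrow> complex"
  where "cinner_complex z w = z * cnj w"

instance
  by standard
    (auto simp: scaleC_complex_def cinner_complex_def algebra_simps scaleR_conv_of_real
      complex_mult_cnj cmod_def)

end

text \<open>
  A (possibly unbounded) operator is given by its domain \<open>D\<close> and a map \<open>A\<close> whose values outside
  \<open>D\<close> are irrelevant.
\<close>

definition linear_operator :: "'h::complex_hilbert_space set \<Rightarrow> ('h \<Rightarrow> 'h) \<Rightarrow> bool"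
  where "linear_operator D A \<longleftrightarrow>
    0 \<in> D \<and>
    (\<forall>x\<in>D. \<forall>y\<in>D. x + y \<in> D \<and> A (x + y) = A x + A y) \<and>
    (\<forall>c. \<forall>x\<in>D. c *\<^sub>C x \<in> D \<and> A (c *\<^sub>C x) = c *\<^sub>C A x)"

definition adjoint_graph :: "'h::complex_hilbert_space set \<Rightarrow> ('h \<Rightarrow> 'h) \<Rightarrow> ('h \<times> 'h) set"
  where "adjoint_graph D A = {(y, z). \<forall>x\<in>D. cinner (A x) y = cinner x z}"

definition self_adjoint :: "'h::complex_hilbert_space set \<Rightarrow> ('h \<Rightarrow> 'h) \<Rightarrow> bool"
  where "self_adjoint D A \<longleftrightarrow>
    linear_operator D A \<and> closure D = UNIV \<and> adjoint_graph D A = {(x, A x) | x. x \<in> D}"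

text \<open>For self-adjoint \<open>A\<close> the numbers \<open>cinner (A x) x\<close> are real.\<close>

definition positive_operator :: "'h::complex_hilbert_space set \<Rightarrow> ('h \<Rightarrow> 'h) \<Rightarrow> bool"
  where "positive_operator D A \<longleftrightarrow> (\<forall>x\<in>D. 0 \<le> Re (cinner (A x) x))"

definition L2 :: "'w measure \<Rightarrow> ('w \<Rightarrow> complex) set"
  where "L2 M = {g \<in> borel_measurable M. integrable M (\<lambda>\<xi>. (cmod (g \<xi>))\<^sup>2)}"

text \<open>
  A unitary map onto the Hilbert space of almost-everywhere classes of \<open>L2 M\<close>: \<open>U x\<close> is an arbitrary
  representative of the class of the image of \<open>x\<close>, so all requirements are modulo null sets.
\<close>

definition unitary_onto_L2 :: "'w measure \<Rightarrow> ('h::complex_hilbert_space \<Rightarrow> 'w \<Rightarrow> complex) \<Rightarrow> bool"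
  where "unitary_onto_L2 M U \<longleftrightarrow>
    (\<forall>x. U x \<in> L2 M) \<and>
    (\<forall>x y. AE \<xi> in M. U (x + y) \<xi> = U x \<xi> + U y \<xi>) \<and>
    (\<forall>c x. AE \<xi> in M. U (c *\<^sub>C x) \<xi> = c * U x \<xi>) \<and>
    (\<forall>x y. cinner x y = (LINT \<xi>|M. U x \<xi> * cnj (U y \<xi>))) \<and>
    (\<forall>g\<in>L2 M. \<exists>x. AE \<xi> in M. U x \<xi> = g \<xi>)"

text \<open>
  \<open>U A U\<^sup>-\<^sup>1\<close> is multiplication by \<open>m\<close> on its maximal domain, the \<open>g\<close> in \<open>L2 M\<close> with \<open>m g\<close> in \<open>L2 M\<close>.
\<close>

definition conjugate_to_multiplication ::
  "'w measure \<Rightarrow> ('h::complex_hilbert_space \<Rightarrow> 'w \<Rightarrow> complex) \<Rightarrow> ('w \<Rightarrow> real) \<Rightarrow>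
    'h set \<Rightarrow> ('h \<Rightarrow> 'h) \<Rightarrow> bool"
  where "conjugate_to_multiplication M U m D A \<longleftrightarrow>
    (\<forall>x. x \<in> D \<longleftrightarrow> (\<lambda>\<xi>. complex_of_real (m \<xi>) * U x \<xi>) \<in> L2 M) \<and>
    (\<forall>x\<in>D. AE \<xi> in M. U (A x) \<xi> = complex_of_real (m \<xi>) * U x \<xi>)"

text \<open>
  Classical solutions: \<open>C\<^sup>1\<close> on the closed and \<open>C\<^sup>2\<close> on the open half-line, with values in the domain
  of the operator. Values of \<open>u\<close> at negative times play no role.
\<close>

definition epd_solution ::
  "real \<Rightarrow> 'h::complex_hilbert_space set \<Rightarrow> ('h \<Rightarrow> 'h) \<Rightarrow> 'h \<Rightarrow> (real \<Rightarrow> 'h) \<Rightarrow> bool"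
  where "epd_solution lam D A f u \<longleftrightarrow>
    (\<exists>u' u''.
      (\<forall>t\<ge>0. (u has_vector_derivative u' t) (at t within {0..})) \<and>
      continuous_on {0..} u' \<and>
      (\<forall>t>0. (u' has_vector_derivative u'' t) (at t)) \<and>
      continuous_on {0<..} u'' \<and>
      (\<forall>t>0. u t \<in> D \<and> u'' t + (2 * lam / t) *\<^sub>R u' t + A (u t) = 0) \<and>
      u 0 = f \<and> u' 0 = 0)"

definition wave_solution ::
  "'h::complex_hilbert_space set \<Rightarrow> ('h \<Rightarrow> 'h) \<Rightarrow> 'h \<Rightarrow> (real \<Rightarrow> 'h) \<Rightarrow> bool"
  where "wave_solution D A f u \<longleftrightarrow>
    (\<exists>u' u''.
      (\<forall>t. (u has_vector_derivative u' t) (at t)) \<and>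
      (\<forall>t. (u' has_vector_derivative u'' t) (at t)) \<and>
      continuous_on UNIV u'' \<and>
      (\<forall>t. u t \<in> D \<and> u'' t + A (u t) = 0) \<and>
      u 0 = f \<and> u' 0 = 0)"

text \<open>
  For a curve \<open>g\<close> of \<open>L2\<close> classes, the function \<open>g t \<xi>\<close> of \<open>t\<close> at a fixed \<open>\<xi>\<close> depends on an
  uncountable choice of representatives and need not even be measurable. Statements about it refer
  to a version that is continuous in \<open>t\<close> for almost every \<open>\<xi>\<close>; such a version is unique up to a null
  set of \<open>\<xi>\<close> independent of \<open>t\<close> (on intervals \<open>I\<close>).
\<close>

definition continuous_version ::
  "'w measure \<Rightarrow> real set \<Rightarrow> (real \<Rightarrow> 'w \<Rightarrow> complex) \<Rightarrow> (real \<Rightarrow> 'w \<Rightarrow> complex) \<Rightarrow> bool"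
  where "continuous_version M I g h \<longleftrightarrow>
    (\<forall>t\<in>I. AE \<xi> in M. h t \<xi> = g t \<xi>) \<and>
    (AE \<xi> in M. continuous_on I (\<lambda>t. h t \<xi>))"

text \<open>Only used for \<open>x > 0\<close>; \<open>rGamma\<close> is the reciprocal Gamma function.\<close>

definition bessel_J :: "real \<Rightarrow> real \<Rightarrow> real"
  where "bessel_J \<nu> x =
    (\<Sum>k. (- 1) ^ k / fact k * rGamma (\<nu> + real k + 1) * (x / 2) powr (2 * real k + \<nu>))"

definition beta_density :: "real \<Rightarrow> real \<Rightarrow> real \<Rightarrow> real"
  where "beta_density a b x =
    (if 0 < x \<and> x < 1 then x powr (a - 1) * (1 - x) powr (b - 1) / Beta a b else 0)"

text \<open>
  The Bochner integral, defined as \<^const>\<open>has_bochner_integral\<close> but without its restriction to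
  second countable (that is, separable) target spaces.
\<close>

definition has_bochner_integral_gen ::
  "'w measure \<Rightarrow> ('w \<Rightarrow> 'b::real_normed_vector) \<Rightarrow> 'b \<Rightarrow> bool"
  where "has_bochner_integral_gen M g x \<longleftrightarrow>
    g \<in> borel_measurable M \<and>
    (\<exists>s. (\<forall>i. Bochner_Integration.simple_bochner_integrable M (s i)) \<and>
      (\<lambda>i. \<integral>\<^sup>+\<omega>. norm (g \<omega> - s i \<omega>) \<partial>M) \<longlonglongrightarrow> 0 \<and>
      (\<lambda>i. Bochner_Integration.simple_bochner_integral M (s i)) \<longlonglongrightarrow> x)"

end

theory Submission
  imports Defs
begin

text \<open>
  Under \<open>U\<close> both evolution problems become scalar: the wave solution is \<open>cos (t \<surd>m)\<close> times \<open>U f\<close>, and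
  the Euler-Poisson-Darboux solution is \<open>j (t \<surd>m)\<close> times \<open>U f\<close>, where
  \<open>j s = E[cos (s \<surd>X)]\<close> for a Beta variable \<open>X\<close>. Integrating a total derivative over the unit interval
  gives the differential equation of \<open>j\<close>, the moments of the Beta law give its Bessel series, and the
  substitution \<open>x = w\<^sup>2 / t\<^sup>2\<close> gives the Poisson integral. Since \<open>j\<close> and its derivatives are bounded,
  dominated convergence lifts the scalar calculus to \<open>L2\<close> when \<open>f\<close> is in the domain. Uniqueness is an energy
  estimate; as a solution need only be \<open>C\<^sup>1\<close> at time zero, \<open>A (u t)\<close> may a priori be unbounded there, so the
  estimate is applied after cutting off to \<open>{m \<le> n}\<close>, where \<open>A\<close> is bounded.
\<close>

text \<open>Both solutions are functions of the square root of \<open>A\<close> applied to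
  \<open>f\<close>, so one calculus of \<open>curve\<close> with bounded symbols serves the two
  problems. Each time derivative of \<open>\<phi> (t * sqrt (m \<xi>))\<close> costs a factor
  \<open>sqrt (m \<xi>)\<close>. Two derivatives cost \<open>m \<xi>\<close>, and
  \<open>f \<in> D\<close> makes both \<open>sqrt (m \<xi>) * cmod (U f \<xi>)\<close> and
  \<open>m \<xi> * cmod (U f \<xi>)\<close> square integrable; these are the majorants for dominated
  convergence.

  The recurring obstacle is that \<open>U\<close> yields classes only, with a separate null set for
  each time. Every passage to all times therefore goes through countably many of them: sequences for
  limits and derivatives, rational times plus continuity for the continuous versions.

  The parameter 1/2 of the Beta law is the one for which the square root of the variable has density
  proportional to \<open>(1 - w\<^sup>2) powr (lam - 1)\<close> on the unit interval, which is the
  weight of the Poisson integral.\<close>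

section \<open>Difference quotients and differentiation under the integral\<close>

text \<open>This form of the mean value inequality dominates the difference quotients met below. The
  case \<open>s = t\<close> is included because division by zero gives zero.\<close>

lemma abs_difference_quotient_le:
  fixes \<phi> :: "real \<Rightarrow> real"
  assumes deriv: "\<And>s. (\<phi> has_real_derivative \<phi>' s) (at s)"
    and bound: "\<And>s. \<bar>\<phi>' s\<bar> \<le> K"
  shows "\<bar>(\<phi> s - \<phi> t) / (s - t)\<bar> \<le> K"
proof (cases "s = t")
  case True
  have "0 \<le> K" using bound[of 0] by linarith
  with True show ?thesis by simp
next
  case False
  have "norm (\<phi> s - \<phi> t) \<le> K * norm (s - t)"
    by (rule field_differentiable_bound[of UNIV \<phi> \<phi>']) (use deriv bound in auto)
  with False show ?thesis by (simp add: abs_divide field_simps)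
qed

text \<open>Dominated convergence along sequences tending to \<open>t\<close>. The bound must hold
  for all \<open>s\<close> outside one null set, since the mean value inequality for a fixed
  \<open>x\<close> ranges over every \<open>s\<close>.\<close>

lemma integral_has_real_derivative:
  fixes G :: "real \<Rightarrow> 'a \<Rightarrow> real"
  assumes int: "\<And>s. integrable N (G s)"
    and deriv: "\<And>s x. ((\<lambda>s. G s x) has_real_derivative G' s x) (at s)"
    and meas: "\<And>s. G' s \<in> borel_measurable N"
    and bound: "AE x in N. \<forall>s. \<bar>G' s x\<bar> \<le> h x"
    and h: "integrable N h"
  shows "((\<lambda>s. LINT x|N. G s x) has_real_derivative (LINT x|N. G' t x)) (at t)"
  unfolding has_field_derivative_iff tendsto_at_iff_sequentially comp_def
proof (intro allI impI)
  fix S :: "nat \<Rightarrow> real"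
  assume S: "\<forall>i. S i \<in> UNIV - {t}" and lim: "S \<longlonglongrightarrow> t"
  have "(\<lambda>i. LINT x|N. (G (S i) x - G t x) / (S i - t)) \<longlonglongrightarrow> (LINT x|N. G' t x)"
  proof (rule integral_dominated_convergence[where w = h])
    show "AE x in N. (\<lambda>i. (G (S i) x - G t x) / (S i - t)) \<longlonglongrightarrow> G' t x"
      using deriv[of _ t] S lim
      by (auto simp: has_field_derivative_iff tendsto_at_iff_sequentially comp_def)
    show "AE x in N. norm ((G (S i) x - G t x) / (S i - t)) \<le> h x" for i
      using bound
    proof eventually_elim
      case (elim x)
      then show ?case
        using abs_difference_quotient_le[OF deriv[where x = x], of "h x" "S i" t] by simp
    qed
  qed (use int meas h borel_measurable_integrable in auto)
  then show "(\<lambda>i. ((LINT x|N. G (S i) x) - (LINT x|N. G t x)) / (S i - t)) \<longlonglongrightarrow> (LINT x|N. G' t x)"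
    using int by simp
qed

section \<open>The Beta law\<close>

lemma Beta_pos: "a > 0 \<Longrightarrow> b > 0 \<Longrightarrow> Beta a b > (0::real)"
  by (simp add: Beta_def Gamma_real_pos)

lemma beta_density_measurable [measurable]: "beta_density a b \<in> borel_measurable borel"
  unfolding beta_density_def by measurable

lemma beta_density_nonneg: "a > 0 \<Longrightarrow> b > 0 \<Longrightarrow> 0 \<le> beta_density a b x"
  using Beta_pos[of a b] by (simp add: beta_density_def)

text \<open>The law is placed on the real line so that the kernel depends on \<open>lam\<close>
  alone and not on the probability space that carries the random time.\<close>

definition beta_law :: "real \<Rightarrow> real measure"
  where "beta_law lam = density lborel (\<lambda>x. ennreal (beta_density (1/2) lam x))"

lemma sets_beta_law [measurable_cong, simp]: "sets (beta_law lam) = sets borel"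
  and space_beta_law [simp]: "space (beta_law lam) = UNIV"
  by (simp_all add: beta_law_def)

lemma AE_beta_law: "AE x in beta_law lam. 0 < x \<and> x < 1"
  unfolding beta_law_def by (subst AE_density) (auto simp: beta_density_def)

text \<open>A factor \<open>x ^ k\<close> only raises the first Beta parameter from \<open>a\<close>
  to \<open>a + k\<close>. The case \<open>k = 0\<close> normalises the law; the other cases are its
  moments.\<close>

lemma nn_integral_beta_density_power:
  assumes "a > 0" "b > 0"
  shows "(\<integral>\<^sup>+x. ennreal (beta_density a b x * x ^ k) \<partial>lborel) = ennreal (Beta (a + real k) b / Beta a b)"
proof (rule nn_integral_has_integral_lborel)
  show "0 \<le> beta_density a b x * x ^ k" for x
    using Beta_pos[OF assms] by (simp add: beta_density_def)
  have "((\<lambda>x. x powr (a + real k - 1) * (1 - x) powr (b - 1) / Beta a b) has_integral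
      Beta (a + real k) b / Beta a b) {0..1}"
    using has_integral_Beta_real[of "a + real k" b] assms by (intro has_integral_divide) auto
  then have "((\<lambda>x. x powr (a + real k - 1) * (1 - x) powr (b - 1) / Beta a b) has_integral
      Beta (a + real k) b / Beta a b) {0<..<1}"
    by (simp add: has_integral_Icc_iff_Ioo)
  then have "((\<lambda>x. if x \<in> {0<..<1} then
        x powr (a + real k - 1) * (1 - x) powr (b - 1) / Beta a b else 0) has_integral
      Beta (a + real k) b / Beta a b) UNIV"
    by (simp only: has_integral_restrict_UNIV)
  moreover have "(\<lambda>x. if x \<in> {0<..<1} then
        x powr (a + real k - 1) * (1 - x) powr (b - 1) / Beta a b else 0) =
      (\<lambda>x. beta_density a b x * x ^ k)"
    by (auto simp: fun_eq_iff beta_density_def powr_realpow[symmetric] powr_add[symmetric] algebra_simps)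
  ultimately show "((\<lambda>x. beta_density a b x * x ^ k) has_integral Beta (a + real k) b / Beta a b) UNIV"
    by simp
qed simp

lemma prob_space_beta_law:
  assumes "lam > 0"
  shows "prob_space (beta_law lam)"
proof
  have "(\<integral>\<^sup>+x. ennreal (beta_density (1/2) lam x) \<partial>lborel) = 1"
    using nn_integral_beta_density_power[of "1/2" lam 0] assms Beta_pos[of "1/2" lam] by simp
  then show "emeasure (beta_law lam) (space (beta_law lam)) = 1"
    by (simp add: beta_law_def emeasure_density)
qed

lemma beta_law_moment:
  assumes "lam > 0"
  shows "(LINT x|beta_law lam. x ^ k) = Beta (1/2 + real k) lam / Beta (1/2) lam"
proof -
  have "(LINT x|beta_law lam. x ^ k) = (LINT x|lborel. beta_density (1/2) lam x * x ^ k)"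
    unfolding beta_law_def using assms
    by (subst integral_density) (auto simp: beta_density_nonneg)
  also have "\<dots> = enn2real (\<integral>\<^sup>+x. ennreal (beta_density (1/2) lam x * x ^ k) \<partial>lborel)"
    using Beta_pos[of "1/2" lam] assms
    by (intro integral_eq_nn_integral) (auto simp: beta_density_def)
  also have "\<dots> = Beta (1/2 + real k) lam / Beta (1/2) lam"
    using assms nn_integral_beta_density_power[of "1/2" lam k] Beta_pos[of "1/2" lam]
      Beta_pos[of "1/2 + real k" lam] by simp
  finally show ?thesis .
qed

section \<open>The Bessel kernel as an average over the Beta law\<close>

text \<open>\<open>bcos lam 0\<close> is the kernel \<open>j\<close>. The index \<open>k\<close>
  counts the factors \<open>sqrt x\<close> brought down by differentiation in \<open>s\<close>, so
  this family and \<open>bsin\<close> are closed under derivatives: the first derivative of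
  \<open>j\<close> is \<open>- bsin lam 1\<close> and the second is
  \<open>- bcos lam 2\<close>.\<close>

definition bcos :: "real \<Rightarrow> nat \<Rightarrow> real \<Rightarrow> real"
  where "bcos lam k s = (LINT x|beta_law lam. sqrt x ^ k * cos (s * sqrt x))"

definition bsin :: "real \<Rightarrow> nat \<Rightarrow> real \<Rightarrow> real"
  where "bsin lam k s = (LINT x|beta_law lam. sqrt x ^ k * sin (s * sqrt x))"

text \<open>Since \<open>sqrt x\<close> stays below 1 under the law, differentiating never worsens
  the bound. The quantifier over \<open>s\<close> stands inside the null set, as
  \<open>integral_has_real_derivative\<close> demands.\<close>

lemma AE_beta_law_bound:
  "AE x in beta_law lam. \<forall>s. \<bar>sqrt x ^ k * cos (s * sqrt x)\<bar> \<le> 1 \<and> \<bar>sqrt x ^ k * sin (s * sqrt x)\<bar> \<le> 1"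
  using AE_beta_law
proof eventually_elim
  case (elim x)
  then have "\<bar>sqrt x ^ k\<bar> \<le> 1" by (simp add: power_le_one)
  then show ?case by (auto simp: abs_mult intro!: mult_le_one)
qed

lemma integrable_bcos_bsin:
  assumes "lam > 0"
  shows "integrable (beta_law lam) (\<lambda>x. sqrt x ^ k * cos (s * sqrt x))"
    and "integrable (beta_law lam) (\<lambda>x. sqrt x ^ k * sin (s * sqrt x))"
proof -
  interpret prob_space "beta_law lam" by (rule prob_space_beta_law[OF assms])
  show "integrable (beta_law lam) (\<lambda>x. sqrt x ^ k * cos (s * sqrt x))"
    "integrable (beta_law lam) (\<lambda>x. sqrt x ^ k * sin (s * sqrt x))"
    by (rule integrable_const_bound[where B = 1],
        use AE_beta_law_bound[of k lam] in \<open>auto elim: eventually_mono\<close>)+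
qed

lemma has_derivative_bcos_bsin:
  assumes "lam > 0"
  shows "(bcos lam k has_real_derivative - bsin lam (Suc k) s) (at s)"
    and "(bsin lam k has_real_derivative bcos lam (Suc k) s) (at s)"
proof -
  interpret prob_space "beta_law lam" by (rule prob_space_beta_law[OF assms])
  have "((\<lambda>s. LINT x|beta_law lam. sqrt x ^ k * cos (s * sqrt x)) has_real_derivative
      (LINT x|beta_law lam. - (sqrt x ^ Suc k * sin (s * sqrt x)))) (at s)"
    by (rule integral_has_real_derivative[where h = "\<lambda>_. 1"])
       (use AE_beta_law_bound[of "Suc k" lam] integrable_bcos_bsin[OF assms] in
         \<open>auto intro!: derivative_eq_intros elim: eventually_mono\<close>)
  then show "(bcos lam k has_real_derivative - bsin lam (Suc k) s) (at s)"
    by (simp add: bcos_def[abs_def] bsin_def)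
  have "((\<lambda>s. LINT x|beta_law lam. sqrt x ^ k * sin (s * sqrt x)) has_real_derivative
      (LINT x|beta_law lam. sqrt x ^ Suc k * cos (s * sqrt x))) (at s)"
    by (rule integral_has_real_derivative[where h = "\<lambda>_. 1"])
       (use AE_beta_law_bound[of "Suc k" lam] integrable_bcos_bsin[OF assms] in
         \<open>auto intro!: derivative_eq_intros elim: eventually_mono\<close>)
  then show "(bsin lam k has_real_derivative bcos lam (Suc k) s) (at s)"
    by (simp add: bsin_def[abs_def] bcos_def)
qed

text \<open>An average of values in [-1, 1]. The bound 1 is the one asked of the symbols of
  \<open>curve\<close>.\<close>

lemma abs_bcos_bsin_le:
  assumes "lam > 0"
  shows "\<bar>bcos lam k s\<bar> \<le> 1" "\<bar>bsin lam k s\<bar> \<le> 1"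
proof -
  interpret prob_space "beta_law lam" by (rule prob_space_beta_law[OF assms])
  have "bcos lam k s \<le> 1" "- 1 \<le> bcos lam k s" "bsin lam k s \<le> 1" "- 1 \<le> bsin lam k s"
    unfolding bcos_def bsin_def
    by (intro integral_le_const integral_ge_const integrable_bcos_bsin assms,
        use AE_beta_law_bound[of k lam] in \<open>eventually_elim, simp add: abs_le_iff minus_le_iff\<close>)+
  then show "\<bar>bcos lam k s\<bar> \<le> 1" "\<bar>bsin lam k s\<bar> \<le> 1"
    by linarith+
qed

lemma bcos_bsin_0:
  assumes "lam > 0"
  shows "bcos lam 0 0 = 1" "bsin lam k 0 = 0"
proof -
  interpret prob_space "beta_law lam" by (rule prob_space_beta_law[OF assms])
  show "bcos lam 0 0 = 1" "bsin lam k 0 = 0"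
    by (simp_all add: bcos_def bsin_def prob_space[simplified])
qed

lemma integral_beta_law:
  assumes "lam > 0" "\<phi> \<in> borel_measurable borel"
  shows "integrable (beta_law lam) \<phi> \<longleftrightarrow> integrable lborel (\<lambda>x. beta_density (1/2) lam x * \<phi> x)"
    and "(LINT x|beta_law lam. \<phi> x) = (LINT x|lborel. beta_density (1/2) lam x * \<phi> x)"
  unfolding beta_law_def using assms
  by (subst integrable_density integral_density; auto simp: beta_density_nonneg)+

text \<open>The Euler-Poisson-Darboux equation for the kernel integrates the derivative of
  \<open>2 (1 - x)\<^sup>\<lambda> sin (s \<surd>x)\<close>, which vanishes at both ends of the unit interval.\<close>

lemma bcos_ode:
  assumes "lam > 0"
  shows "s * (bcos lam 0 s - bcos lam 2 s) = 2 * lam * bsin lam 1 s"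
proof -
  define B where "B = Beta (1/2) lam"
  have B: "B > 0" unfolding B_def using assms by (intro Beta_pos) auto
  \<comment> \<open>The density times \<open>G\<close> is the total derivative. The powers 0, 1 and
    2 of \<open>sqrt x\<close> are written out so that the summands are literally the integrands of
    \<open>bcos\<close> and \<open>bsin\<close>.\<close>
  define G where "G x = s * (sqrt x ^ 0 * cos (s * sqrt x) - sqrt x ^ 2 * cos (s * sqrt x)) -
    2 * lam * (sqrt x ^ 1 * sin (s * sqrt x))" for x
  have [measurable]: "G \<in> borel_measurable borel" unfolding G_def by measurable
  note int = integrable_bcos_bsin[OF assms]
  have "integrable (beta_law lam) G"
    unfolding G_def by (intro Bochner_Integration.integrable_diff integrable_mult_right int)
  then have F: "integrable lborel (\<lambda>x. beta_density (1/2) lam x * G x)"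
    using integral_beta_law(1)[OF assms, of G] by simp
  have "(LINT x|beta_law lam. G x) = s * (bcos lam 0 s - bcos lam 2 s) - 2 * lam * bsin lam 1 s"
    unfolding G_def bcos_def bsin_def
    by (subst Bochner_Integration.integral_diff | intro integrable_mult_right int Bochner_Integration.integrable_diff
      | subst integral_mult_right_zero)+ simp
  moreover have "(LINT x|lborel. beta_density (1/2) lam x * G x) = 0"
  proof -
    have "((\<lambda>x. beta_density (1/2) lam x * G x) has_integral
        2 * (1 - 1) powr lam * sin (s * sqrt 1) / B - 2 * (1 - 0) powr lam * sin (s * sqrt 0) / B) {0..1}"
    \<comment> \<open>Only continuity is available at the ends: \<open>sqrt\<close> is not
      differentiable at 0, nor is \<open>(1 - x) powr lam\<close> at 1 when \<open>lam < 1\<close>.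
      Positivity of \<open>lam\<close> gives continuity at 1.\<close>
    proof (rule fundamental_theorem_of_calculus_interior)
      show "continuous_on {0..1} (\<lambda>x. 2 * (1 - x) powr lam * sin (s * sqrt x) / B)"
        using assms B by (intro continuous_intros continuous_on_powr') auto
      show "((\<lambda>x. 2 * (1 - x) powr lam * sin (s * sqrt x) / B) has_vector_derivative
          beta_density (1/2) lam x * G x) (at x)" if "x \<in> {0<..<1}" for x
      proof -
        have x: "0 < x" "x < 1" using that by auto
        have p: "(1 - x) powr lam = (1 - x) powr (lam - 1) * (1 - x)"
          using x by (simp add: powr_diff)
        have q: "x powr (1 / 2 - 1) = 1 / sqrt x"
          using x powr_minus[of x "1/2"] by (simp add: powr_half_sqrt inverse_eq_divide)
        have d: "((\<lambda>x. 2 * (1 - x) powr lam * sin (s * sqrt x) / B) has_real_derivative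
            (2 * (1 - x) powr lam * (cos (s * sqrt x) * (s * (inverse (sqrt x) / 2))) +
             2 * (lam * (1 - x) powr (lam - 1) * (- 1)) * sin (s * sqrt x)) / B) (at x)"
          using x B by (auto intro!: derivative_eq_intros simp: field_simps)
        have "(2 * (1 - x) powr lam * (cos (s * sqrt x) * (s * (inverse (sqrt x) / 2))) +
             2 * (lam * (1 - x) powr (lam - 1) * (- 1)) * sin (s * sqrt x)) / B =
             beta_density (1/2) lam x * G x"
          using x B unfolding beta_density_def G_def p B_def[symmetric] q
          by (simp add: field_simps power2_eq_square)
        with d show ?thesis by (simp add: has_real_derivative_iff_has_vector_derivative)
      qed
    qed simp
    then have "((\<lambda>x. beta_density (1/2) lam x * G x) has_integral 0) {0..1}"
      using assms by simp
    then have "((\<lambda>x. beta_density (1/2) lam x * G x) has_integral 0) UNIV"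
      by (rule has_integral_on_superset) (auto simp: beta_density_def)
    \<comment> \<open>Integrability was inherited from the law, so the gauge integral just computed
      is also the Lebesgue integral.\<close>
    with has_integral_integral_lborel[OF F] show ?thesis by (rule has_integral_unique)
  qed
  ultimately show ?thesis
    using integral_beta_law(2)[OF assms, of G] by simp
qed

text \<open>The cosine series contains even powers only, so the square roots disappear and its k-th
  term averages to a multiple of the k-th moment. As \<open>x < 1\<close> and
  \<open>fact k \<le> fact (2 * k)\<close>, the exponential series of \<open>s\<^sup>2\<close> is a
  summable majorant that justifies the exchange of sum and integral.\<close>

lemma bcos_sums:
  assumes "lam > 0"
  shows "(\<lambda>k. (- 1) ^ k / fact (2 * k) * s ^ (2 * k) * (Beta (1/2 + real k) lam / Beta (1/2) lam))
    sums bcos lam 0 s"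
proof -
  interpret prob_space "beta_law lam" by (rule prob_space_beta_law[OF assms])
  let ?f = "\<lambda>k x. (- 1) ^ k / fact (2 * k) * (s * sqrt x) ^ (2 * k)"
  have bound: "AE x in beta_law lam. norm (?f k x) \<le> (s\<^sup>2) ^ k / fact k" for k
    using AE_beta_law
  proof eventually_elim
    case (elim x)
    have "norm (?f k x) = (s\<^sup>2) ^ k * x ^ k / fact (2 * k)"
      using elim by (simp add: abs_mult power_mult power_mult_distrib)
    also have "\<dots> \<le> (s\<^sup>2) ^ k * 1 / fact k"
      using elim by (intro frac_le mult_mono) (auto simp: power_le_one fact_mono)
    finally show ?case by simp
  qed
  have sum: "summable (\<lambda>k. (s\<^sup>2) ^ k / fact k :: real)"
    using summable_exp[of "s\<^sup>2"] by (simp add: field_simps)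
  have int: "integrable (beta_law lam) (?f k)" for k
    by (rule integrable_const_bound[OF bound]) simp
  have "(\<lambda>k. LINT x|beta_law lam. ?f k x) sums (LINT x|beta_law lam. (\<Sum>k. ?f k x))"
  proof (rule sums_integral)
    show "AE x in beta_law lam. summable (\<lambda>k. norm (?f k x))"
    proof -
      have "AE x in beta_law lam. \<forall>k. norm (?f k x) \<le> (s\<^sup>2) ^ k / fact k"
        using bound by (subst AE_all_countable) auto
      then show ?thesis
        by eventually_elim (rule summable_comparison_test'[OF sum, of 0], auto)
    qed
    show "summable (\<lambda>k. LINT x|beta_law lam. norm (?f k x))"
    proof (rule summable_comparison_test'[OF sum, of 0])
      fix k :: nat
      have "(LINT x|beta_law lam. norm (?f k x)) \<le> (s\<^sup>2) ^ k / fact k"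
        by (rule integral_le_const[OF integrable_norm[OF int] bound])
      then show "norm (LINT x|beta_law lam. norm (?f k x)) \<le> (s\<^sup>2) ^ k / fact k"
        by (simp add: integral_nonneg_AE)
    qed
  qed (rule int)
  moreover have "(\<Sum>k. ?f k x) = sqrt x ^ 0 * cos (s * sqrt x)" for x
    using cos_paired[of "s * sqrt x"] by (simp add: sums_iff)
  moreover have "(LINT x|beta_law lam. ?f k x) =
      (- 1) ^ k / fact (2 * k) * s ^ (2 * k) * (Beta (1/2 + real k) lam / Beta (1/2) lam)" for k
  proof -
    have "(LINT x|beta_law lam. ?f k x) =
        (LINT x|beta_law lam. (- 1) ^ k / fact (2 * k) * s ^ (2 * k) * x ^ k)"
    proof (rule integral_cong_AE)
      show "AE x in beta_law lam. ?f k x = (- 1) ^ k / fact (2 * k) * s ^ (2 * k) * x ^ k"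
        using AE_beta_law
        by eventually_elim (simp add: power_mult_distrib power_mult)
    qed simp_all
    then show ?thesis using beta_law_moment[OF assms, of k] by simp
  qed
  ultimately show ?thesis by (simp add: bcos_def)
qed

text \<open>Brings the factor \<open>fact (2 * k)\<close> into the moments, where it cancels the
  denominator of the cosine series and leaves the \<open>4 ^ k * fact k\<close> of the Bessel
  series.\<close>

lemma Gamma_half_plus_nat: "Gamma (1/2 + real k) = fact (2 * k) / (4 ^ k * fact k) * Gamma (1/2)"
proof (induction k)
  case (Suc k)
  have "Gamma (1/2 + real k + 1) = (1/2 + real k) * Gamma (1/2 + real k)"
    by (rule Gamma_plus1) (auto elim!: nonpos_Ints_cases)
  also have "(1/2 + real k) * Gamma (1/2 + real k) =
      (1/2 + real k) * (fact (2 * k) / (4 ^ k * fact k)) * Gamma (1/2)"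
    using Suc by simp
  also have "(1/2 + real k) * (fact (2 * k) / (4 ^ k * fact k)) =
      fact (2 * Suc k) / (4 ^ Suc k * fact (Suc k))"
  proof -
    have "fact (2 * Suc k) = (2 * real k + 2) * ((2 * real k + 1) * fact (2 * k))"
      by (simp add: algebra_simps)
    then have "fact (2 * Suc k) / (4 ^ Suc k * fact (Suc k)) =
        ((2 * real k + 2) * (2 * real k + 1) / (4 * (real k + 1))) * (fact (2 * k) / (4 ^ k * fact k))"
      by (simp only: power_Suc fact_Suc[of k] of_nat_Suc of_nat_mult times_divide_times_eq)
        (rule arg_cong2[where f = "(/)"], simp_all add: algebra_simps)
    also have "(2 * real k + 2) * (2 * real k + 1) / (4 * (real k + 1)) = 1/2 + real k"
      by (simp add: divide_simps) (simp add: algebra_simps)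
    finally show ?thesis by simp
  qed
  finally show ?case by (simp add: add_ac)
qed simp

text \<open>The two series agree term by term: the ratio of Beta values supplies
  \<open>Gamma (lam + 1/2)\<close> and the reciprocal Gamma factor, while
  \<open>(2 / s) powr (lam - 1/2)\<close> removes the power of \<open>s\<close> by which the Bessel
  series differs from an even power series.\<close>

lemma bcos_eq_bessel_J:
  assumes "lam > 0" "s > 0"
  shows "bcos lam 0 s = (2 / s) powr (lam - 1/2) * Gamma (lam + 1/2) * bessel_J (lam - 1/2) s"
proof -
  define c where "c = (2 / s) powr (lam - 1/2) * Gamma (lam + 1/2)"
  have c: "c > 0" unfolding c_def using assms by (simp add: Gamma_real_pos)
  have eq: "(- 1) ^ k / fact (2 * k) * s ^ (2 * k) * (Beta (1/2 + real k) lam / Beta (1/2) lam) =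
      c * ((- 1) ^ k / fact k * rGamma ((lam - 1/2) + real k + 1) *
        (s / 2) powr (2 * real k + (lam - 1/2)))" for k
  proof -
    have pw: "(2 / s) powr (lam - 1/2) * (s / 2) powr (2 * real k + (lam - 1/2)) = (s / 2) ^ (2 * k)"
    proof -
      have "(2 / s) powr (lam - 1/2) = (s / 2) powr (- (lam - 1/2))"
        using inverse_powr[of "s / 2" "lam - 1/2"] powr_minus[of "s / 2" "lam - 1/2"] assms by simp
      then have "(2 / s) powr (lam - 1/2) * (s / 2) powr (2 * real k + (lam - 1/2)) =
          (s / 2) powr real (2 * k)"
        by (simp only: powr_add[symmetric]) simp
      also have "\<dots> = (s / 2) ^ (2 * k)" using assms by (subst powr_realpow) auto
      finally show ?thesis .
    qed
    have pos: "Gamma (1/2 :: real) > 0" "Gamma lam > 0" "Gamma (lam + 1/2) > 0"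
      "Gamma (lam + 1/2 + real k) > 0" using assms by (auto intro!: Gamma_real_pos)
    have "c * ((- 1) ^ k / fact k * rGamma ((lam - 1/2) + real k + 1) *
        (s / 2) powr (2 * real k + (lam - 1/2))) =
        Gamma (lam + 1/2) * ((- 1) ^ k / fact k * rGamma (lam + 1/2 + real k)) *
        ((2 / s) powr (lam - 1/2) * (s / 2) powr (2 * real k + (lam - 1/2)))"
      by (simp add: c_def algebra_simps)
    also have "\<dots> = Gamma (lam + 1/2) * ((- 1) ^ k / fact k * rGamma (lam + 1/2 + real k)) *
        (s / 2) ^ (2 * k)" by (simp only: pw)
    also have "\<dots> = (- 1) ^ k / fact (2 * k) * s ^ (2 * k) *
        (Beta (1/2 + real k) lam / Beta (1/2) lam)"
    proof -
      have s: "(s / 2) ^ (2 * k) = s ^ (2 * k) / 4 ^ k"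
        by (simp add: power_divide power_mult)
      define q where "q = Gamma (1 / 2 :: real)"
      have lam: "1 / 2 + real k + lam = lam + 1 / 2 + real k" "1 / 2 + lam = lam + 1 / 2" by simp_all
      show ?thesis
        using pos unfolding s Beta_def Gamma_half_plus_nat lam rGamma_inverse_Gamma q_def[symmetric]
        by (simp add: divide_simps)
    qed
    finally show ?thesis ..
  qed
  have "(\<lambda>k. c * ((- 1) ^ k / fact k * rGamma ((lam - 1/2) + real k + 1) *
        (s / 2) powr (2 * real k + (lam - 1/2)))) sums bcos lam 0 s"
    using bcos_sums[OF assms(1), of s] unfolding eq .
  \<comment> \<open>Dividing inside \<open>sums\<close> also yields convergence of the Bessel
    series, so its \<open>suminf\<close> has the intended value.\<close>
  then have "(\<lambda>k. ((- 1) ^ k / fact k * rGamma ((lam - 1/2) + real k + 1) *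
        (s / 2) powr (2 * real k + (lam - 1/2)))) sums (bcos lam 0 s / c)"
    using c by (auto dest: sums_divide[where c = c])
  then show ?thesis
    using c unfolding bessel_J_def c_def[symmetric] by (simp add: sums_iff)
qed

text \<open>The substitution \<open>x = w\<^sup>2 / t\<^sup>2\<close> in the Beta density, followed by even reflection.\<close>

lemma has_bochner_integral_bcos:
  assumes "lam > 0" "t > 0"
  shows "has_bochner_integral lborel
    (\<lambda>w. indicator {- t..t} w * ((1 - w\<^sup>2 / t\<^sup>2) powr (lam - 1) * cos (r * w)))
    (Beta lam (1/2) * t * bcos lam 0 (t * r))"
proof -
  define B where "B = Beta (1/2) lam"
  have B: "B > 0" unfolding B_def using assms by (intro Beta_pos) auto
  define g where "g w = w\<^sup>2 / t\<^sup>2" for w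
  define F where "F x = beta_density (1/2) lam x * (sqrt x ^ 0 * cos ((t * r) * sqrt x))" for x
  have F: "integrable lborel F" "(LINT x|lborel. F x) = bcos lam 0 (t * r)"
    unfolding F_def bcos_def using integrable_bcos_bsin(1)[OF assms(1), of 0 "t * r"]
    by (subst (asm) integral_beta_law[OF assms(1)]; simp add: integral_beta_law[OF assms(1)])+
  have g01: "g 0 = 0" "g t = 1" using assms by (simp_all add: g_def)
  have Fi: "F x * indicator {g 0..g t} x = F x" for x
    by (auto simp: F_def g01 beta_density_def indicator_def)
  have setint: "set_integrable lborel {g 0..g t} F"
    unfolding set_integrable_def real_scaleR_def mult.commute[of "indicator _ _"] Fi by (rule F(1))
  have "(g has_real_derivative 2 * w / t\<^sup>2) (at w)" for w
    unfolding g_def using assms by (auto intro!: derivative_eq_intros simp: field_simps)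
  then have sub: "set_integrable lborel {0..t} (\<lambda>w. F (g w) * (2 * w / t\<^sup>2))"
    "(LINT x|lborel. F x * indicator {g 0..g t} x) = (LINT w|lborel. F (g w) * (2 * w / t\<^sup>2) * indicator {0..t} w)"
    using assms by (intro integral_substitution[where g = g and a = 0 and b = t and f = F, OF setint]; auto intro!: continuous_intros)+
  define h where "h w = indicator {0..t} w * (F (g w) * (2 * w / t\<^sup>2))" for w
  have h: "has_bochner_integral lborel h (bcos lam 0 (t * r))"
    using sub F(2) unfolding Fi h_def has_bochner_integral_iff set_integrable_def
    by (simp add: mult_ac)
  \<comment> \<open>The mirror image of \<open>h\<close>, written in the affine shape of the
    substitution rule, with slope -1 and shift 0.\<close>
  have h': "has_bochner_integral lborel (\<lambda>w. h (0 + (- 1) * w)) (bcos lam 0 (t * r))"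
    using h by (subst (asm) lborel_has_bochner_integral_real_affine_iff[of "- 1" _ _ 0]) auto
  \<comment> \<open>For \<open>0 < w < t\<close> the factor \<open>2 * w / t\<^sup>2\<close> from
    the substitution and \<open>t / w\<close> from \<open>x powr (- 1/2)\<close> leave
    \<open>2 / t\<close>, and the density contributes \<open>1 / B\<close>. Multiplication by
    \<open>B * t / 2\<close> removes both.\<close>
  have "has_bochner_integral lborel (\<lambda>w. (h w + h (0 + (- 1) * w)) * (B * t / 2))
      ((bcos lam 0 (t * r) + bcos lam 0 (t * r)) * (B * t / 2))"
    by (intro has_bochner_integral_mult_left has_bochner_integral_add h h')
  \<comment> \<open>Equality fails at \<open>w = 0\<close>, where the left side is 0 and the right
    side is 1.\<close>
  moreover have "AE w in lborel. (h w + h (0 + (- 1) * w)) * (B * t / 2) =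
      indicator {- t..t} w * ((1 - w\<^sup>2 / t\<^sup>2) powr (lam - 1) * cos (r * w))"
  proof -
    have pos: "h w * (B * t / 2) = indicator {0..t} w * ((1 - w\<^sup>2 / t\<^sup>2) powr (lam - 1) * cos (r * w))"
      if "w \<noteq> 0" for w
    proof (cases "w \<in> {0<..<t}")
      case True
      then have w: "0 < w" "w < t" by auto
      have "w\<^sup>2 < t\<^sup>2" using w by (intro power_strict_mono) auto
      then have g: "0 < g w" "g w < 1" using w assms by (auto simp: g_def)
      have sg: "sqrt (g w) = w / t" using w assms by (simp add: g_def real_sqrt_divide)
      have "g w powr (1 / 2 - 1) = 1 / sqrt (g w)"
        using g powr_minus[of "g w" "1/2"] by (simp add: powr_half_sqrt inverse_eq_divide)
      then show ?thesis using w g assms B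
        unfolding h_def F_def beta_density_def sg B_def[symmetric] unfolding g_def
        by (simp add: field_simps power2_eq_square)
    next
      case False
      \<comment> \<open>At \<open>w = t\<close> both sides are 0: the density is cut off at 1, and
        \<open>0 powr a\<close> is 0 for every exponent.\<close>
      then show ?thesis using that assms
        by (cases "w = t") (auto simp: h_def F_def g01 beta_density_def indicator_def)
    qed
    have "AE w in lborel. w \<noteq> (0::real)" by (rule AE_lborel_singleton)
    then show ?thesis
    proof eventually_elim
      case (elim w)
      then show ?case
        using pos[of w] pos[of "- w"] assms by (auto simp: distrib_right indicator_def)
    qed
  qed
  moreover have "(bcos lam 0 (t * r) + bcos lam 0 (t * r)) * (B * t / 2) =
      Beta lam (1/2) * t * bcos lam 0 (t * r)"
    by (simp add: B_def Beta_commute)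
  ultimately show ?thesis
    by (subst has_bochner_integral_cong_AE[symmetric]) (auto simp: has_bochner_integral_iff)
qed

section \<open>The real inner product and the energy estimate\<close>

text \<open>Scalars are restricted to the reals because time and energy are real; conjugate symmetry
  then becomes plain symmetry.\<close>

definition rinner :: "'h::complex_hilbert_space \<Rightarrow> 'h \<Rightarrow> real"
  where "rinner x y = Re (cinner x y)"

lemma rinner_commute: "rinner x y = rinner y x"
  by (subst rinner_def, subst cinner_commute) (simp add: rinner_def)

lemma rinner_add_left: "rinner (x + y) z = rinner x z + rinner y z"
  by (simp add: rinner_def cinner_add_left)

lemma rinner_add_right: "rinner x (y + z) = rinner x y + rinner x z"
  by (metis rinner_add_left rinner_commute)

lemma rinner_scaleR_left: "rinner (r *\<^sub>R x) y = r * rinner x y"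
  by (simp add: rinner_def scaleC_of_real[symmetric] cinner_scaleC_left)

lemma rinner_scaleR_right: "rinner x (r *\<^sub>R y) = r * rinner x y"
  by (metis rinner_scaleR_left rinner_commute)

lemma norm_sq_eq_rinner: "(norm x)\<^sup>2 = rinner x x"
proof -
  have "sqrt (rinner x x) = norm x" by (simp add: rinner_def norm_eq_sqrt_cinner)
  then show ?thesis by (metis norm_ge_zero real_sqrt_ge_0_iff real_sqrt_pow2)
qed

lemma abs_rinner_le: "\<bar>rinner x y\<bar> \<le> norm x * norm y"
proof (cases "y = 0")
  case True
  then show ?thesis using rinner_scaleR_right[of x 0 y] by simp
next
  case False
  \<comment> \<open>For Cauchy-Schwarz: \<open>a + b\<close> is the component of \<open>x\<close>
    orthogonal to \<open>y\<close>, scaled by \<open>(norm y)\<^sup>2\<close> to avoid a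
    division.\<close>
  define a where "a = (norm y)\<^sup>2 *\<^sub>R x"
  define b where "b = (- rinner x y) *\<^sub>R y"
  have "0 \<le> (norm (a + b))\<^sup>2" by simp
  also have "(norm (a + b))\<^sup>2 = (norm y)\<^sup>2 * ((norm x * norm y)\<^sup>2 - (rinner x y)\<^sup>2)"
    unfolding norm_sq_eq_rinner a_def b_def power_mult_distrib
    by (simp only: rinner_add_left rinner_add_right rinner_scaleR_left rinner_scaleR_right)
       (simp add: rinner_commute[of y x] algebra_simps power2_eq_square)
  finally have "(rinner x y)\<^sup>2 \<le> (norm x * norm y)\<^sup>2"
    using False by (simp add: zero_le_mult_iff)
  then show ?thesis by (metis abs_le_square_iff abs_of_nonneg mult_nonneg_nonneg norm_ge_zero)
qed

lemma bounded_bilinear_rinner: "bounded_bilinear rinner"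
  by standard (auto simp: rinner_add_left rinner_add_right rinner_scaleR_left rinner_scaleR_right
      intro!: exI[of _ 1] abs_rinner_le)

text \<open>The energy \<open>rinner (w' t) (w' t) + rinner (B (w t)) (w t)\<close> has derivative
  \<open>- (2 * c / t) * rinner (w' t) (w' t)\<close>, so it does not increase. It starts at 0 and
  both summands are nonnegative, hence \<open>w'\<close> vanishes and \<open>w\<close> is constant.
  The singular coefficient meets only positive times; at 0 the energy is merely continuous, which is
  where boundedness of \<open>B\<close> enters.\<close>

lemma damped_wave_unique:
  fixes w w' w'' :: "real \<Rightarrow> 'h::complex_hilbert_space"
  assumes c: "c \<ge> 0" and B: "bounded_linear B"
    and sym: "\<And>x y. rinner (B x) y = rinner x (B y)" and pos: "\<And>x. 0 \<le> rinner (B x) x"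
    and w: "\<And>t. t \<ge> 0 \<Longrightarrow> (w has_vector_derivative w' t) (at t within {0..})"
    and cont: "continuous_on {0..} w'"
    and w': "\<And>t. t > 0 \<Longrightarrow> (w' has_vector_derivative w'' t) (at t)"
    and eq: "\<And>t. t > 0 \<Longrightarrow> w'' t + (c / t) *\<^sub>R w' t + B (w t) = 0"
    and zero: "w 0 = 0" "w' 0 = 0" and t: "t \<ge> 0"
  shows "w t = 0"
proof -
  interpret B: bounded_linear B by (rule B)
  interpret rinner: bounded_bilinear rinner by (rule bounded_bilinear_rinner)
  define E where "E t = rinner (w' t) (w' t) + rinner (B (w t)) (w t)" for t
  have contw: "continuous_on {0..} w"
    using w by (intro continuous_on_vector_derivative) auto
  have "continuous_on {0..} E"
    unfolding E_def by (intro continuous_intros rinner.continuous_on B.continuous_on cont contw)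
  moreover have "(E has_real_derivative - (2 * c / t) * rinner (w' t) (w' t)) (at t)" if t: "t > 0" for t
  proof -
    have w_at: "(w has_vector_derivative w' t) (at t)"
      using w[of t] t at_within_interior[of t "{0..}"] by (simp add: interior_real_atLeast)
    have d: "(E has_vector_derivative
        (rinner (w' t) (w'' t) + rinner (w'' t) (w' t)) +
        (rinner (B (w t)) (w' t) + rinner (B (w' t)) (w t))) (at t)"
      unfolding E_def
      by (intro has_vector_derivative_add rinner.has_vector_derivative w' t w_at
          B.has_vector_derivative)
    have e1: "rinner (B (w' t)) (w t) = rinner (B (w t)) (w' t)"
      by (metis sym rinner_commute)
    have e2: "rinner (w'' t) (w' t) + rinner (B (w t)) (w' t) = - (c / t) * rinner (w' t) (w' t)"
    proof -
      have "rinner (w'' t + (c / t) *\<^sub>R w' t + B (w t)) (w' t) = 0"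
        using eq[OF t] by (simp add: rinner.zero_left)
      then show ?thesis by (simp add: rinner_add_left rinner_scaleR_left)
    qed
    have "(rinner (w' t) (w'' t) + rinner (w'' t) (w' t)) +
        (rinner (B (w t)) (w' t) + rinner (B (w' t)) (w t)) = - (2 * c / t) * rinner (w' t) (w' t)"
    proof -
      have "(rinner (w' t) (w'' t) + rinner (w'' t) (w' t)) +
          (rinner (B (w t)) (w' t) + rinner (B (w' t)) (w t)) =
          2 * (rinner (w'' t) (w' t) + rinner (B (w t)) (w' t))"
        unfolding e1 rinner_commute[of "w' t" "w'' t"] by simp
      then show ?thesis unfolding e2 by simp
    qed
    then show ?thesis using d by (simp only: has_real_derivative_iff_has_vector_derivative)
  qed
  ultimately have "E t \<le> E 0" if "t > 0" for t
    using that c norm_sq_eq_rinner[of "w' _", symmetric]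
    by (intro DERIV_nonpos_imp_decreasing_open[of 0 t E])
       (auto intro!: exI mult_nonneg_nonneg elim: continuous_on_subset)
  moreover have "E 0 = 0" by (simp add: E_def zero rinner.zero_left)
  ultimately have "rinner (w' t) (w' t) \<le> 0" if "t > 0" for t
    using that pos[of "w t"] unfolding E_def by force
  then have w'0: "(norm (w' t))\<^sup>2 \<le> 0" if "t > 0" for t
    using that by (simp only: norm_sq_eq_rinner)
  have "w' t = 0" if "t \<ge> 0" for t
    using that zero w'0[of t] by (cases "t = 0") simp_all
  with w have "(w has_derivative (\<lambda>h. 0)) (at t within {0..})" if "t \<in> {0..}" for t
    using that by (force simp: has_vector_derivative_def)
  then obtain a where "\<And>s. s \<in> {0..} \<Longrightarrow> w s = a"
    using has_derivative_zero_constant[of "{0..}" w] by (auto simp: convex_real_interval)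
  from this[of t] this[of 0] show ?thesis using zero t by simp
qed

section \<open>Multiplication operators\<close>

lemma measurable_cnj [measurable]: "cnj \<in> borel_measurable borel"
  by (intro borel_measurable_continuous_onI continuous_on_cnj continuous_on_id)

locale diagonalization =
  fixes M :: "'w measure" and U :: "'h::complex_hilbert_space \<Rightarrow> 'w \<Rightarrow> complex"
    and m :: "'w \<Rightarrow> real" and D :: "'h set" and A :: "'h \<Rightarrow> 'h"
  assumes unitary: "unitary_onto_L2 M U"
    and m_meas [measurable]: "m \<in> borel_measurable M"
    and m_pos: "\<And>\<xi>. \<xi> \<in> space M \<Longrightarrow> m \<xi> > 0"
    and diag: "conjugate_to_multiplication M U m D A"
begin

lemma U_meas [measurable]: "U x \<in> borel_measurable M"
  and U_integrable: "integrable M (\<lambda>\<xi>. (cmod (U x \<xi>))\<^sup>2)"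
  and U_add: "AE \<xi> in M. U (x + y) \<xi> = U x \<xi> + U y \<xi>"
  and U_scaleC: "AE \<xi> in M. U (c *\<^sub>C x) \<xi> = c * U x \<xi>"
  using unitary by (auto simp: unitary_onto_L2_def L2_def)

lemma U_scaleR: "AE \<xi> in M. U (r *\<^sub>R x) \<xi> = complex_of_real r * U x \<xi>"
  using U_scaleC[of "complex_of_real r" x] by (simp add: scaleC_of_real)

lemma U_diff: "AE \<xi> in M. U (x - y) \<xi> = U x \<xi> - U y \<xi>"
  using U_add[of x "(- 1) *\<^sub>R y"] U_scaleR[of "- 1" y] by eventually_elim simp

lemma U_zero: "AE \<xi> in M. U 0 \<xi> = 0"
  using U_scaleR[of 0 0] by simp

lemma U_sum:
  assumes "finite I"
  shows "AE \<xi> in M. U (\<Sum>i\<in>I. x i) \<xi> = (\<Sum>i\<in>I. U (x i) \<xi>)"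
  using assms
proof (induction I)
  case empty
  then show ?case using U_zero by simp
next
  case (insert i I)
  from insert.IH U_add[of "x i" "\<Sum>i\<in>I. x i"] show ?case
    by eventually_elim (simp add: insert.hyps)
qed

lemma cinner_eq: "cinner x y = (LINT \<xi>|M. U x \<xi> * cnj (U y \<xi>))"
  using unitary by (auto simp: unitary_onto_L2_def)

lemma norm_sq_eq: "(norm x)\<^sup>2 = (LINT \<xi>|M. (cmod (U x \<xi>))\<^sup>2)"
proof -
  have "(norm x)\<^sup>2 = Re (LINT \<xi>|M. U x \<xi> * cnj (U x \<xi>))"
    by (simp add: norm_sq_eq_rinner rinner_def cinner_eq)
  also have "\<dots> = Re (LINT \<xi>|M. complex_of_real ((cmod (U x \<xi>))\<^sup>2))"
    by (simp add: complex_mult_cnj cmod_power2)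
  finally show ?thesis by (simp only: integral_complex_of_real Re_complex_of_real)
qed

text \<open>The isometry turns pointwise domination of representatives into an inequality of norms;
  norm estimates below are proved this way.\<close>

lemma norm_le:
  assumes "AE \<xi> in M. cmod (U x \<xi>) \<le> K * cmod (U y \<xi>)" "K \<ge> 0"
  shows "norm x \<le> K * norm y"
proof -
  have "(norm x)\<^sup>2 \<le> (LINT \<xi>|M. K\<^sup>2 * (cmod (U y \<xi>))\<^sup>2)"
    unfolding norm_sq_eq
  proof (intro integral_mono_AE integrable_mult_right U_integrable)
    show "AE \<xi> in M. (cmod (U x \<xi>))\<^sup>2 \<le> K\<^sup>2 * (cmod (U y \<xi>))\<^sup>2"
      using assms(1) by eventually_elim (metis norm_ge_zero power_mono power_mult_distrib)
  qed
  also have "\<dots> = (K * norm y)\<^sup>2" by (simp add: norm_sq_eq power_mult_distrib)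
  finally show ?thesis by (rule power2_le_imp_le) (simp add: assms)
qed

text \<open>Injectivity of \<open>U\<close>: identities between vectors are checked on
  representatives.\<close>

lemma eq_if_AE_eq:
  assumes "AE \<xi> in M. U x \<xi> = U y \<xi>"
  shows "x = y"
proof -
  have "AE \<xi> in M. cmod (U (x - y) \<xi>) \<le> 0 * cmod (U y \<xi>)"
    using U_diff[of x y] assms by eventually_elim simp
  then have "norm (x - y) \<le> 0 * norm y" by (rule norm_le) simp
  then show ?thesis by simp
qed

lemma L2_if_bounded:
  assumes [measurable]: "g \<in> borel_measurable M" and "AE \<xi> in M. cmod (g \<xi>) \<le> K * cmod (U x \<xi>)"
  shows "g \<in> L2 M"
proof -
  have "integrable M (\<lambda>\<xi>. (cmod (g \<xi>))\<^sup>2)"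
  proof (rule Bochner_Integration.integrable_bound)
    show "integrable M (\<lambda>\<xi>. K\<^sup>2 * (cmod (U x \<xi>))\<^sup>2)"
      by (intro integrable_mult_right U_integrable)
    show "AE \<xi> in M. norm ((cmod (g \<xi>))\<^sup>2) \<le> norm (K\<^sup>2 * (cmod (U x \<xi>))\<^sup>2)"
      using assms(2)
      by eventually_elim (metis abs_of_nonneg norm_ge_zero norm_power power_mono
          power_mult_distrib real_norm_def zero_le_power2 norm_mult abs_norm_cancel)
  qed simp
  then show ?thesis by (simp add: L2_def)
qed

text \<open>Dominated convergence for vectors. The limit inherits the bound, so the squared
  difference is at most \<open>(2 * K)\<^sup>2 * (cmod (U y \<xi>))\<^sup>2\<close>, which is
  integrable. Sequences keep the exceptional sets countable in number.\<close>

lemma tendsto_if_dominated: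
  assumes bound: "\<And>i. AE \<xi> in M. cmod (U (X i) \<xi>) \<le> K * cmod (U y \<xi>)"
    and lim: "AE \<xi> in M. (\<lambda>i. U (X i) \<xi>) \<longlonglongrightarrow> U x \<xi>"
  shows "X \<longlonglongrightarrow> x"
proof -
  have "(\<lambda>i. LINT \<xi>|M. (cmod (U (X i) \<xi> - U x \<xi>))\<^sup>2) \<longlonglongrightarrow> (LINT \<xi>|M. 0)"
  proof (rule integral_dominated_convergence[where w = "\<lambda>\<xi>. (2 * K)\<^sup>2 * (cmod (U y \<xi>))\<^sup>2"])
    show "integrable M (\<lambda>\<xi>. (2 * K)\<^sup>2 * (cmod (U y \<xi>))\<^sup>2)"
      by (intro integrable_mult_right U_integrable)
    show "AE \<xi> in M. (\<lambda>i. (cmod (U (X i) \<xi> - U x \<xi>))\<^sup>2) \<longlonglongrightarrow> 0"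
      using lim
    proof eventually_elim
      case (elim \<xi>)
      then have "(\<lambda>i. (cmod (U (X i) \<xi> - U x \<xi>))\<^sup>2) \<longlonglongrightarrow> (cmod (U x \<xi> - U x \<xi>))\<^sup>2"
        by (intro tendsto_intros)
      then show ?case by simp
    qed
    have all: "AE \<xi> in M. \<forall>i. cmod (U (X i) \<xi>) \<le> K * cmod (U y \<xi>)"
      using bound by (subst AE_all_countable) auto
    show "AE \<xi> in M. norm ((cmod (U (X i) \<xi> - U x \<xi>))\<^sup>2) \<le> (2 * K)\<^sup>2 * (cmod (U y \<xi>))\<^sup>2" for i
      using all lim
    proof eventually_elim
      case (elim \<xi>)
      have "cmod (U x \<xi>) \<le> K * cmod (U y \<xi>)"
        by (rule tendsto_upperbound[OF tendsto_norm[OF elim(2)]]) (use elim in auto)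
      moreover have "cmod (U (X i) \<xi>) \<le> K * cmod (U y \<xi>)" using elim by blast
      ultimately have "cmod (U (X i) \<xi> - U x \<xi>) \<le> K * cmod (U y \<xi>) + K * cmod (U y \<xi>)"
        using norm_triangle_ineq4[of "U (X i) \<xi>" "U x \<xi>"] by linarith
      then have "cmod (U (X i) \<xi> - U x \<xi>) \<le> 2 * K * cmod (U y \<xi>)" by simp
      then have "(cmod (U (X i) \<xi> - U x \<xi>))\<^sup>2 \<le> (2 * K * cmod (U y \<xi>))\<^sup>2"
        by (intro power_mono) auto
      then show ?case by (simp add: power_mult_distrib)
    qed
  qed simp_all
  moreover have "(LINT \<xi>|M. (cmod (U (X i) \<xi> - U x \<xi>))\<^sup>2) = (norm (X i - x))\<^sup>2" for i
    unfolding norm_sq_eq using U_diff[of "X i" x]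
    by (intro integral_cong_AE) (auto elim: eventually_mono)
  ultimately have "(\<lambda>i. (norm (X i - x))\<^sup>2) \<longlonglongrightarrow> 0" by simp
  from tendsto_real_sqrt[OF this] have "(\<lambda>i. norm (X i - x)) \<longlonglongrightarrow> 0" by simp
  then show ?thesis by (simp add: tendsto_norm_zero_iff LIM_zero_iff)
qed

text \<open>For \<open>g\<close> in \<open>L2 M\<close> the choice is unique by
  \<open>eq_if_AE_eq\<close>; elsewhere the value is arbitrary.\<close>

definition Uinv :: "('w \<Rightarrow> complex) \<Rightarrow> 'h"
  where "Uinv g = (SOME x. AE \<xi> in M. U x \<xi> = g \<xi>)"

lemma U_Uinv: "g \<in> L2 M \<Longrightarrow> AE \<xi> in M. U (Uinv g) \<xi> = g \<xi>"
  unfolding Uinv_def by (rule someI_ex) (use unitary in \<open>auto simp: unitary_onto_L2_def\<close>)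

text \<open>Multiplication by a real symbol, conjugated back to the Hilbert space. For a bounded
  Borel function of \<open>m\<close> this is the corresponding function of \<open>A\<close>.\<close>

definition mult :: "('w \<Rightarrow> real) \<Rightarrow> 'h \<Rightarrow> 'h"
  where "mult \<phi> x = Uinv (\<lambda>\<xi>. complex_of_real (\<phi> \<xi>) * U x \<xi>)"

lemma U_mult:
  assumes [measurable]: "\<phi> \<in> borel_measurable M" and bound: "\<forall>\<xi>\<in>space M. \<bar>\<phi> \<xi>\<bar> \<le> K"
  shows "AE \<xi> in M. U (mult \<phi> x) \<xi> = complex_of_real (\<phi> \<xi>) * U x \<xi>"
  unfolding mult_def
  by (intro U_Uinv L2_if_bounded[where K = K and x = x])
     (use bound in \<open>auto intro!: AE_I2 mult_right_mono simp: norm_mult\<close>)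

lemma bounded_linear_mult:
  assumes \<phi>: "\<phi> \<in> borel_measurable M" "\<forall>\<xi>\<in>space M. \<bar>\<phi> \<xi>\<bar> \<le> K"
  shows "bounded_linear (mult \<phi>)"
proof (rule bounded_linear_intro[where K = "\<bar>K\<bar>"])
  note U_mult = U_mult[OF \<phi>]
  show "mult \<phi> (x + y) = mult \<phi> x + mult \<phi> y" for x y
  proof (rule eq_if_AE_eq)
    show "AE \<xi> in M. U (mult \<phi> (x + y)) \<xi> = U (mult \<phi> x + mult \<phi> y) \<xi>"
      using U_mult[of "x + y"] U_mult[of x] U_mult[of y] U_add[of x y] U_add[of "mult \<phi> x" "mult \<phi> y"]
      by eventually_elim (simp add: algebra_simps)
  qed
  show "mult \<phi> (r *\<^sub>R x) = r *\<^sub>R mult \<phi> x" for r x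
  proof (rule eq_if_AE_eq)
    show "AE \<xi> in M. U (mult \<phi> (r *\<^sub>R x)) \<xi> = U (r *\<^sub>R mult \<phi> x) \<xi>"
      using U_mult[of "r *\<^sub>R x"] U_mult[of x] U_scaleR[of r x] U_scaleR[of r "mult \<phi> x"]
      by eventually_elim (simp add: algebra_simps)
  qed
  show "norm (mult \<phi> x) \<le> norm x * \<bar>K\<bar>" for x
  proof (subst mult.commute, rule norm_le)
    show "AE \<xi> in M. cmod (U (mult \<phi> x) \<xi>) \<le> \<bar>K\<bar> * cmod (U x \<xi>)"
      using U_mult[of x] AE_space
    proof eventually_elim
      case (elim \<xi>)
      then show ?case using \<phi>(2) by (force simp: norm_mult intro!: mult_right_mono)
    qed
  qed simp
qed

lemma rinner_mult_sym:
  assumes \<phi>: "\<phi> \<in> borel_measurable M" "\<forall>\<xi>\<in>space M. \<bar>\<phi> \<xi>\<bar> \<le> K"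
  shows "rinner (mult \<phi> x) y = rinner x (mult \<phi> y)"
proof -
  have [measurable]: "\<phi> \<in> borel_measurable M" by fact
  have "(LINT \<xi>|M. U (mult \<phi> x) \<xi> * cnj (U y \<xi>)) = (LINT \<xi>|M. U x \<xi> * cnj (U (mult \<phi> y) \<xi>))"
  proof (rule integral_cong_AE)
    show "AE \<xi> in M. U (mult \<phi> x) \<xi> * cnj (U y \<xi>) = U x \<xi> * cnj (U (mult \<phi> y) \<xi>)"
      using U_mult[OF \<phi>, of x] U_mult[OF \<phi>, of y] by eventually_elim simp
  qed simp_all
  then show ?thesis by (simp add: rinner_def cinner_eq)
qed

lemma rinner_mult_nonneg:
  assumes \<phi>: "\<phi> \<in> borel_measurable M" "\<forall>\<xi>\<in>space M. \<bar>\<phi> \<xi>\<bar> \<le> K"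
    and nonneg: "\<And>\<xi>. \<xi> \<in> space M \<Longrightarrow> 0 \<le> \<phi> \<xi>"
  shows "0 \<le> rinner (mult \<phi> x) x"
proof -
  have [measurable]: "\<phi> \<in> borel_measurable M" by fact
  have "(LINT \<xi>|M. U (mult \<phi> x) \<xi> * cnj (U x \<xi>)) =
      (LINT \<xi>|M. complex_of_real (\<phi> \<xi> * (cmod (U x \<xi>))\<^sup>2))"
  proof (rule integral_cong_AE)
    show "AE \<xi> in M. U (mult \<phi> x) \<xi> * cnj (U x \<xi>) = complex_of_real (\<phi> \<xi> * (cmod (U x \<xi>))\<^sup>2)"
      using U_mult[OF \<phi>, of x] by eventually_elim (simp only: of_real_mult complex_norm_square mult.assoc)
  qed simp_all
  moreover have "0 \<le> (LINT \<xi>|M. \<phi> \<xi> * (cmod (U x \<xi>))\<^sup>2)"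
    using nonneg by (intro integral_nonneg_AE AE_I2) auto
  ultimately show ?thesis
    by (simp only: rinner_def cinner_eq integral_complex_of_real Re_complex_of_real)
qed

end

section \<open>Functions of the square root of the operator and their time derivatives\<close>

lemma has_vector_derivative_if_tendsto:
  fixes f :: "real \<Rightarrow> 'a::real_normed_vector"
  assumes "((\<lambda>s. (f s - f t) /\<^sub>R (s - t)) \<longlongrightarrow> d) (at t)"
  shows "(f has_vector_derivative d) (at t)"
  unfolding has_vector_derivative_def has_derivative_at_within
proof
  show "bounded_linear (\<lambda>h. h *\<^sub>R d)" by (rule bounded_linear_scaleR_left)
  have "((\<lambda>s. norm ((f s - f t) /\<^sub>R (s - t) - d)) \<longlongrightarrow> 0) (at t)"
    using assms by (intro tendsto_norm_zero LIM_zero)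
  moreover have "\<forall>\<^sub>F s in at t. norm ((f s - f t) /\<^sub>R (s - t) - d) =
      norm (((f s - f t) - (s - t) *\<^sub>R d) /\<^sub>R norm (s - t))"
    using eventually_neq_at_within[of t t UNIV]
  proof eventually_elim
    case (elim s)
    then have "(f s - f t) /\<^sub>R (s - t) - d = ((f s - f t) - (s - t) *\<^sub>R d) /\<^sub>R (s - t)"
      by (simp add: scaleR_diff_right)
    then show ?case by simp
  qed
  ultimately have "((\<lambda>s. norm (((f s - f t) - (s - t) *\<^sub>R d) /\<^sub>R norm (s - t))) \<longlongrightarrow> 0) (at t)"
    by (simp add: tendsto_cong)
  then show "((\<lambda>s. (f s - f t - (s - t) *\<^sub>R d) /\<^sub>R norm (s - t)) \<longlongrightarrow> 0) (at t)"
    by (rule tendsto_norm_zero_cancel)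
qed

context diagonalization
begin

text \<open>For the bounded continuous symbols used below this is \<open>\<phi>\<close> evaluated at
  \<open>t\<close> times the square root of \<open>A\<close>, applied to \<open>x\<close>:
  \<open>cos\<close> gives the wave, \<open>bcos lam 0\<close> the Euler-Poisson-Darboux
  solution.\<close>

definition curve :: "(real \<Rightarrow> real) \<Rightarrow> 'h \<Rightarrow> real \<Rightarrow> 'h"
  where "curve \<phi> x t = mult (\<lambda>\<xi>. \<phi> (t * sqrt (m \<xi>))) x"

lemma symbol:
  assumes "continuous_on UNIV \<phi>" "\<forall>s. \<bar>\<phi> s\<bar> \<le> (1::real)"
  shows "(\<lambda>\<xi>. \<phi> (t * sqrt (m \<xi>))) \<in> borel_measurable M"
    and "\<forall>\<xi>\<in>space M. \<bar>\<phi> (t * sqrt (m \<xi>))\<bar> \<le> 1"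
proof -
  have [measurable]: "\<phi> \<in> borel_measurable borel"
    using assms(1) by (rule borel_measurable_continuous_onI)
  show "(\<lambda>\<xi>. \<phi> (t * sqrt (m \<xi>))) \<in> borel_measurable M" by measurable
qed (use assms in auto)

lemma U_curve:
  assumes "continuous_on UNIV \<phi>" "\<forall>s. \<bar>\<phi> s\<bar> \<le> 1"
  shows "AE \<xi> in M. U (curve \<phi> x t) \<xi> = complex_of_real (\<phi> (t * sqrt (m \<xi>))) * U x \<xi>"
  unfolding curve_def by (rule U_mult[OF symbol[OF assms]])

lemma continuous_on_curve:
  assumes \<phi>: "continuous_on UNIV \<phi>" "\<forall>s. \<bar>\<phi> s\<bar> \<le> 1"
  shows "continuous_on S (curve \<phi> x)"
  unfolding continuous_on_sequentially comp_def
proof (intro allI ballI impI, elim conjE)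
  fix T :: "nat \<Rightarrow> real" and t
  assume lim: "T \<longlonglongrightarrow> t"
  have all: "AE \<xi> in M. \<forall>i. U (curve \<phi> x (T i)) \<xi> = complex_of_real (\<phi> (T i * sqrt (m \<xi>))) * U x \<xi>"
    by (subst AE_all_countable) (auto intro: U_curve[OF \<phi>])
  show "(\<lambda>i. curve \<phi> x (T i)) \<longlonglongrightarrow> curve \<phi> x t"
  proof (rule tendsto_if_dominated[where K = 1 and y = x])
    show "AE \<xi> in M. cmod (U (curve \<phi> x (T i)) \<xi>) \<le> 1 * cmod (U x \<xi>)" for i
      using U_curve[OF \<phi>, of x "T i"]
      by eventually_elim (use \<phi>(2) in \<open>simp add: norm_mult mult_left_le_one_le\<close>)
    show "AE \<xi> in M. (\<lambda>i. U (curve \<phi> x (T i)) \<xi>) \<longlonglongrightarrow> U (curve \<phi> x t) \<xi>"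
      using all U_curve[OF \<phi>, of x t]
    proof eventually_elim
      case (elim \<xi>)
      have "(\<lambda>i. \<phi> (T i * sqrt (m \<xi>))) \<longlonglongrightarrow> \<phi> (t * sqrt (m \<xi>))"
        by (rule continuous_on_tendsto_compose[OF \<phi>(1)]) (auto intro!: tendsto_intros lim)
      then have "(\<lambda>i. complex_of_real (\<phi> (T i * sqrt (m \<xi>))) * U x \<xi>) \<longlonglongrightarrow>
          complex_of_real (\<phi> (t * sqrt (m \<xi>))) * U x \<xi>"
        by (intro tendsto_intros)
      with elim show ?case by simp
    qed
  qed
qed

text \<open>The vector \<open>y\<close> stands for the square root of \<open>A\<close> applied to
  \<open>x\<close>. By the mean value inequality the difference quotients have symbols at most
  \<open>sqrt (m \<xi>)\<close>, so \<open>y\<close> dominates them. The derivative is again a curve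
  with a bounded symbol, and the lemma can be iterated along \<open>x\<close>,
  \<open>sqrtA x\<close>, \<open>A x\<close>.\<close>

lemma curve_has_vector_derivative:
  assumes deriv: "\<forall>s. (\<phi> has_real_derivative \<phi>' s) (at s)" and \<phi>: "\<forall>s. \<bar>\<phi> s\<bar> \<le> 1"
    and \<phi>': "continuous_on UNIV \<phi>'" "\<forall>s. \<bar>\<phi>' s\<bar> \<le> 1"
    and y: "AE \<xi> in M. U y \<xi> = complex_of_real (sqrt (m \<xi>)) * U x \<xi>"
  shows "(curve \<phi> x has_vector_derivative curve \<phi>' y t) (at t)"
proof (rule has_vector_derivative_if_tendsto)
  have \<phi>_cont: "continuous_on UNIV \<phi>"
    using deriv by (intro DERIV_continuous_on) auto
  note U_c = U_curve[OF \<phi>_cont \<phi>]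
  show "((\<lambda>s. (curve \<phi> x s - curve \<phi> x t) /\<^sub>R (s - t)) \<longlongrightarrow> curve \<phi>' y t) (at t)"
    unfolding tendsto_at_iff_sequentially comp_def
  proof (intro allI impI)
    fix S :: "nat \<Rightarrow> real"
    assume S: "\<forall>i. S i \<in> UNIV - {t}" and lim: "S \<longlonglongrightarrow> t"
    define X where "X i = (curve \<phi> x (S i) - curve \<phi> x t) /\<^sub>R (S i - t)" for i
    define Q where "Q i \<xi> = (\<phi> (S i * sqrt (m \<xi>)) - \<phi> (t * sqrt (m \<xi>))) / (S i - t)" for i \<xi>
    have UX: "AE \<xi> in M. U (X i) \<xi> = complex_of_real (Q i \<xi>) * U x \<xi>" for i
      using U_scaleR[of "inverse (S i - t)" "curve \<phi> x (S i) - curve \<phi> x t"]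
        U_diff[of "curve \<phi> x (S i)" "curve \<phi> x t"] U_c[of x "S i"] U_c[of x t]
      by eventually_elim (simp add: X_def Q_def divide_inverse algebra_simps)
    have d: "((\<lambda>s. \<phi> (s * r)) has_real_derivative \<phi>' (s * r) * r) (at s)" for r s
      by (rule DERIV_chain2[OF deriv[rule_format]]) (auto intro!: derivative_eq_intros)
    show "(\<lambda>i. (curve \<phi> x (S i) - curve \<phi> x t) /\<^sub>R (S i - t)) \<longlonglongrightarrow> curve \<phi>' y t"
      unfolding X_def[symmetric]
    proof (rule tendsto_if_dominated[where K = 1 and y = y])
      show "AE \<xi> in M. cmod (U (X i) \<xi>) \<le> 1 * cmod (U y \<xi>)" for i
        using UX[of i] y AE_space
      proof eventually_elim
        case (elim \<xi>)
        have "\<bar>Q i \<xi>\<bar> \<le> sqrt (m \<xi>)"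
          unfolding Q_def
          by (rule abs_difference_quotient_le[OF d])
             (use \<phi>'(2) m_pos[OF elim(3)] in \<open>simp add: abs_mult mult_left_le_one_le\<close>)
        then show ?case using elim m_pos[OF elim(3)]
          by (simp add: norm_mult mult_right_mono)
      qed
      have "AE \<xi> in M. \<forall>i. U (X i) \<xi> = complex_of_real (Q i \<xi>) * U x \<xi>"
        by (subst AE_all_countable) (auto intro: UX)
      then show "AE \<xi> in M. (\<lambda>i. U (X i) \<xi>) \<longlonglongrightarrow> U (curve \<phi>' y t) \<xi>"
        using y U_curve[OF \<phi>', of y t]
      proof eventually_elim
        case (elim \<xi>)
        have "(\<lambda>i. Q i \<xi>) \<longlonglongrightarrow> \<phi>' (t * sqrt (m \<xi>)) * sqrt (m \<xi>)"
          using d[of "sqrt (m \<xi>)" t] S lim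
          unfolding has_field_derivative_iff tendsto_at_iff_sequentially comp_def Q_def by auto
        then have "(\<lambda>i. complex_of_real (Q i \<xi>) * U x \<xi>) \<longlonglongrightarrow>
            complex_of_real (\<phi>' (t * sqrt (m \<xi>)) * sqrt (m \<xi>)) * U x \<xi>"
          by (intro tendsto_intros)
        with elim show ?case by (simp add: mult.assoc)
      qed
    qed
  qed
qed

lemma curve_0:
  assumes \<phi>: "continuous_on UNIV \<phi>" "\<forall>s. \<bar>\<phi> s\<bar> \<le> 1"
  shows "\<phi> 0 = 1 \<Longrightarrow> curve \<phi> x 0 = x" "\<phi> 0 = 0 \<Longrightarrow> curve \<phi> x 0 = 0"
  using U_curve[OF \<phi>, of x 0] U_zero by (auto intro!: eq_if_AE_eq)

lemma U_A: "x \<in> D \<Longrightarrow> AE \<xi> in M. U (A x) \<xi> = complex_of_real (m \<xi>) * U x \<xi>"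
  using diag by (auto simp: conjugate_to_multiplication_def)

definition sqrtA :: "'h \<Rightarrow> 'h"
  where "sqrtA x = Uinv (\<lambda>\<xi>. complex_of_real (sqrt (m \<xi>)) * U x \<xi>)"

lemma U_sqrtA:
  assumes "x \<in> D"
  shows "AE \<xi> in M. U (sqrtA x) \<xi> = complex_of_real (sqrt (m \<xi>)) * U x \<xi>"
  unfolding sqrtA_def
proof (intro U_Uinv L2_if_bounded)
  \<comment> \<open>Since \<open>sqrt r \<le> 1 + r\<close> for \<open>r > 0\<close>, the vector
    \<open>x + A x\<close>, whose symbol is \<open>1 + m \<xi>\<close>, is a majorant.\<close>
  show "AE \<xi> in M. cmod (complex_of_real (sqrt (m \<xi>)) * U x \<xi>) \<le> 1 * cmod (U (x + A x) \<xi>)"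
    using U_add[of x "A x"] U_A[OF assms] AE_space
  proof eventually_elim
    case (elim \<xi>)
    have m: "m \<xi> > 0" using elim m_pos by simp
    have "sqrt (m \<xi>) \<le> 1 + m \<xi>"
      using m by (intro real_le_lsqrt) (auto simp: power2_eq_square algebra_simps)
    then have "sqrt (m \<xi>) * cmod (U x \<xi>) \<le> (1 + m \<xi>) * cmod (U x \<xi>)"
      by (rule mult_right_mono) simp
    also have "\<dots> = cmod (complex_of_real (1 + m \<xi>) * U x \<xi>)"
      using m by (simp only: norm_mult norm_of_real)
    also have "complex_of_real (1 + m \<xi>) * U x \<xi> = U (x + A x) \<xi>"
      using elim by (simp add: algebra_simps)
    finally show ?case using m by (simp add: norm_mult)
  qed
qed simp

lemma U_A_sqrtA:
  assumes "x \<in> D"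
  shows "AE \<xi> in M. U (A x) \<xi> = complex_of_real (sqrt (m \<xi>)) * U (sqrtA x) \<xi>"
  using U_A[OF assms] U_sqrtA[OF assms] AE_space
proof eventually_elim
  case (elim \<xi>)
  have "complex_of_real (m \<xi>) = complex_of_real (sqrt (m \<xi>)) * complex_of_real (sqrt (m \<xi>))"
    using m_pos[OF elim(3)] by (simp flip: of_real_mult)
  then show ?case using elim by (simp add: mult.assoc)
qed

lemma curve_in_D:
  assumes \<phi>: "continuous_on UNIV \<phi>" "\<forall>s. \<bar>\<phi> s\<bar> \<le> 1" and x: "x \<in> D"
  shows "curve \<phi> x t \<in> D" "A (curve \<phi> x t) = curve \<phi> (A x) t"
proof -
  have eq: "AE \<xi> in M. complex_of_real (m \<xi>) * U (curve \<phi> x t) \<xi> = U (curve \<phi> (A x) t) \<xi>"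
    using U_curve[OF \<phi>, of x t] U_curve[OF \<phi>, of "A x" t] U_A[OF x]
    by eventually_elim simp
  have "(\<lambda>\<xi>. complex_of_real (m \<xi>) * U (curve \<phi> x t) \<xi>) \<in> L2 M"
    by (rule L2_if_bounded[where K = 1 and x = "curve \<phi> (A x) t"])
       (use eq in \<open>auto elim: eventually_mono\<close>)
  then show D: "curve \<phi> x t \<in> D" using diag by (simp add: conjugate_to_multiplication_def)
  show "A (curve \<phi> x t) = curve \<phi> (A x) t"
    by (rule eq_if_AE_eq) (use U_A[OF D] eq in eventually_elim, simp)
qed

section \<open>Uniqueness for the abstract problems\<close>

text \<open>The curve \<open>h\<close> plays the role of \<open>A\<close> applied to
  \<open>w\<close>, described only through its symbol. For the difference of two solutions it is the
  difference of their images under \<open>A\<close>.\<close>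

lemma spectral_unique:
  fixes w w' w'' h :: "real \<Rightarrow> 'h"
  assumes c: "c \<ge> 0"
    and w: "\<And>t. t \<ge> 0 \<Longrightarrow> (w has_vector_derivative w' t) (at t within {0..})"
    and cont: "continuous_on {0..} w'"
    and w': "\<And>t. t > 0 \<Longrightarrow> (w' has_vector_derivative w'' t) (at t)"
    and h: "\<And>t. t > 0 \<Longrightarrow> AE \<xi> in M. U (h t) \<xi> = complex_of_real (m \<xi>) * U (w t) \<xi>"
    and eq: "\<And>t. t > 0 \<Longrightarrow> w'' t + (c / t) *\<^sub>R w' t + h t = 0"
    and zero: "w 0 = 0" "w' 0 = 0" and t: "t \<ge> 0"
  shows "w t = 0"
proof -
  define P where "P n = mult (\<lambda>\<xi>. if m \<xi> \<le> real n then 1 else 0)" for n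
  define B where "B n = mult (\<lambda>\<xi>. if m \<xi> \<le> real n then m \<xi> else 0)" for n
  have symP: "(\<lambda>\<xi>. if m \<xi> \<le> real n then 1 else 0 :: real) \<in> borel_measurable M"
    "\<forall>\<xi>\<in>space M. \<bar>if m \<xi> \<le> real n then 1 else 0 :: real\<bar> \<le> 1" for n
    by simp_all
  have symB: "(\<lambda>\<xi>. if m \<xi> \<le> real n then m \<xi> else 0) \<in> borel_measurable M"
    "\<forall>\<xi>\<in>space M. \<bar>if m \<xi> \<le> real n then m \<xi> else 0\<bar> \<le> real n" for n
    using m_pos by (simp, force)
  have P: "bounded_linear (P n)" for n
    unfolding P_def by (rule bounded_linear_mult[OF symP])
  have B: "bounded_linear (B n)" for n
    unfolding B_def by (rule bounded_linear_mult[OF symB])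
  \<comment> \<open>Both sides have the representative that is
    \<open>m \<xi> * U (w t) \<xi>\<close> on \<open>{m \<le> n}\<close> and 0 elsewhere; this
    closes the cut-off equation.\<close>
  have PB: "P n (h t) = B n (P n (w t))" if "t > 0" for n t
  proof (rule eq_if_AE_eq)
    show "AE \<xi> in M. U (P n (h t)) \<xi> = U (B n (P n (w t))) \<xi>"
      using U_mult[OF symP, of n "h t"] U_mult[OF symP, of n "w t"] U_mult[OF symB, of n "P n (w t)"] h[OF that]
      unfolding P_def[symmetric] B_def[symmetric]
      by eventually_elim simp
  qed
  have "P n (w t) = 0" for n
  proof (rule damped_wave_unique[OF c B, where w = "\<lambda>t. P n (w t)" and w' = "\<lambda>t. P n (w' t)" and
        w'' = "\<lambda>t. P n (w'' t)"])
    interpret P: bounded_linear "P n" by (rule P)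
    show "rinner (B n x) y = rinner x (B n y)" for x y
      unfolding B_def by (rule rinner_mult_sym[OF symB])
    show "0 \<le> rinner (B n x) x" for x
      unfolding B_def by (rule rinner_mult_nonneg[OF symB]) (use m_pos in \<open>auto simp: less_imp_le\<close>)
    show "((\<lambda>t. P n (w t)) has_vector_derivative P n (w' t)) (at t within {0..})" if "t \<ge> 0" for t
      by (rule P.has_vector_derivative[OF w[OF that]])
    show "((\<lambda>t. P n (w' t)) has_vector_derivative P n (w'' t)) (at t)" if "t > 0" for t
      by (rule P.has_vector_derivative[OF w'[OF that]])
    show "continuous_on {0..} (\<lambda>t. P n (w' t))" by (rule P.continuous_on[OF cont])
    show "P n (w'' t) + (c / t) *\<^sub>R P n (w' t) + B n (P n (w t)) = 0" if "t > 0" for t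
      using arg_cong[OF eq[OF that], of "P n"] PB[OF that, of n] by (simp add: P.add P.scaleR P.zero)
  qed (simp_all add: zero t linear_0[OF bounded_linear.linear[OF P]])
  then have "AE \<xi> in M. U (P n (w t)) \<xi> = 0" for n
    using U_zero by simp
  then have "AE \<xi> in M. complex_of_real (if m \<xi> \<le> real n then 1 else 0) * U (w t) \<xi> = 0" for n
  proof -
    assume "\<And>n. AE \<xi> in M. U (P n (w t)) \<xi> = 0"
    from this[of n] U_mult[OF symP, of n "w t"] show ?thesis
      unfolding P_def[symmetric] by eventually_elim simp
  qed
  then have "AE \<xi> in M. \<forall>n. complex_of_real (if m \<xi> \<le> real n then 1 else 0) * U (w t) \<xi> = 0"
    by (subst AE_all_countable) auto
  then have "AE \<xi> in M. U (w t) \<xi> = U 0 \<xi>"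
    using U_zero
  proof eventually_elim
    case (elim \<xi>)
    \<comment> \<open>The cutoffs exhaust the space because \<open>m\<close> takes finite
      values.\<close>
    obtain n where "m \<xi> \<le> real n" using real_arch_simple by blast
    then show ?case using spec[OF elim(1), of n] elim(2) by simp
  qed
  then show ?thesis by (rule eq_if_AE_eq)
qed

lemma epd_unique:
  assumes "lam \<ge> 0" "epd_solution lam D A x v" "epd_solution lam D A x u" "t \<ge> 0"
  shows "v t = u t"
proof -
  obtain v' v'' where v: "\<forall>t\<ge>0. (v has_vector_derivative v' t) (at t within {0..})"
    "continuous_on {0..} v'" "\<forall>t>0. (v' has_vector_derivative v'' t) (at t)"
    "\<forall>t>0. v t \<in> D \<and> v'' t + (2 * lam / t) *\<^sub>R v' t + A (v t) = 0" "v 0 = x" "v' 0 = 0"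
    using assms(2) unfolding epd_solution_def by blast
  obtain u' u'' where u: "\<forall>t\<ge>0. (u has_vector_derivative u' t) (at t within {0..})"
    "continuous_on {0..} u'" "\<forall>t>0. (u' has_vector_derivative u'' t) (at t)"
    "\<forall>t>0. u t \<in> D \<and> u'' t + (2 * lam / t) *\<^sub>R u' t + A (u t) = 0" "u 0 = x" "u' 0 = 0"
    using assms(3) unfolding epd_solution_def by blast
  have "v t - u t = 0"
  proof (rule spectral_unique[where c = "2 * lam" and w = "\<lambda>t. v t - u t" and w' = "\<lambda>t. v' t - u' t"
        and w'' = "\<lambda>t. v'' t - u'' t" and h = "\<lambda>t. A (v t) - A (u t)"])
    show "((\<lambda>t. v t - u t) has_vector_derivative v' t - u' t) (at t within {0..})" if "t \<ge> 0" for t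
      using u v that by (intro has_vector_derivative_diff) auto
    show "((\<lambda>t. v' t - u' t) has_vector_derivative v'' t - u'' t) (at t)" if "t > 0" for t
      using u v that by (intro has_vector_derivative_diff) auto
    show "continuous_on {0..} (\<lambda>t. v' t - u' t)"
      using u v by (intro continuous_on_diff)
    show "AE \<xi> in M. U (A (v t) - A (u t)) \<xi> = complex_of_real (m \<xi>) * U (v t - u t) \<xi>" if "t > 0" for t
    proof -
      have "v t \<in> D" "u t \<in> D" using u v that by auto
      from U_A[OF this(1)] U_A[OF this(2)] U_diff[of "A (v t)" "A (u t)"] U_diff[of "v t" "u t"]
      show ?thesis by eventually_elim (simp add: right_diff_distrib)
    qed
    show "v'' t - u'' t + (2 * lam / t) *\<^sub>R (v' t - u' t) + (A (v t) - A (u t)) = 0" if "t > 0" for t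
    proof -
      have "v'' t - u'' t + (2 * lam / t) *\<^sub>R (v' t - u' t) + (A (v t) - A (u t)) =
          (v'' t + (2 * lam / t) *\<^sub>R v' t + A (v t)) - (u'' t + (2 * lam / t) *\<^sub>R u' t + A (u t))"
        by (simp add: scaleR_diff_right)
      then show ?thesis using u v that by simp
    qed
  qed (use assms u v in auto)
  then show ?thesis by simp
qed

text \<open>For \<open>lam = 0\<close> the damping term disappears, so a wave restricted to
  nonnegative times solves an Euler-Poisson-Darboux problem.\<close>

lemma wave_unique_nonneg:
  assumes "wave_solution D A x v" "wave_solution D A x u" "t \<ge> 0"
  shows "v t = u t"
proof (rule epd_unique[where lam = 0])
  have "epd_solution 0 D A x v" if wave: "wave_solution D A x v" for v
  proof -
    obtain v' v'' where v: "\<forall>t. (v has_vector_derivative v' t) (at t)"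
      "\<forall>t. (v' has_vector_derivative v'' t) (at t)" "continuous_on UNIV v''"
      "\<forall>t. v t \<in> D \<and> v'' t + A (v t) = 0" "v 0 = x" "v' 0 = 0"
      using wave unfolding wave_solution_def by blast
    have "continuous_on {0..} v'"
      by (rule continuous_on_vector_derivative) (use v in \<open>auto intro: has_vector_derivative_at_within\<close>)
    then show ?thesis
      unfolding epd_solution_def using v
      by (intro exI[of _ v'] exI[of _ v'']) (auto intro: has_vector_derivative_at_within continuous_on_subset)
  qed
  then show "epd_solution 0 D A x v" "epd_solution 0 D A x u" using assms by auto
qed (use assms in auto)

lemma wave_unique:
  assumes "wave_solution D A x v" "wave_solution D A x u"
  shows "v = u"
proof
  fix t
  \<comment> \<open>The wave equation and zero initial velocity are invariant under time reversal,
    which carries uniqueness to negative times.\<close>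
  have reflect: "wave_solution D A x (\<lambda>t. v (- t))" if wave: "wave_solution D A x v" for v
  proof -
    obtain v' v'' where v: "\<forall>t. (v has_vector_derivative v' t) (at t)"
      "\<forall>t. (v' has_vector_derivative v'' t) (at t)" "continuous_on UNIV v''"
      "\<forall>t. v t \<in> D \<and> v'' t + A (v t) = 0" "v 0 = x" "v' 0 = 0"
      using wave unfolding wave_solution_def by blast
    have neg: "(uminus has_vector_derivative - 1) (at t)" for t :: real
      by (auto intro!: derivative_eq_intros)
    have "((\<lambda>t. v (- t)) has_vector_derivative - v' (- t)) (at t)" for t
      using vector_diff_chain_at[OF neg, of v "v' (- t)" t] v by (simp add: comp_def)
    moreover have "((\<lambda>t. - v' (- t)) has_vector_derivative v'' (- t)) (at t)" for t
      using has_vector_derivative_minus[OF vector_diff_chain_at[OF neg, of v' "v'' (- t)" t]] v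
      by (simp add: comp_def)
    moreover have "continuous_on UNIV (\<lambda>t. v'' (- t))"
      by (rule continuous_on_compose2[OF v(3)]) (auto intro: continuous_intros)
    ultimately show ?thesis
      unfolding wave_solution_def using v
      by (intro exI[of _ "\<lambda>t. - v' (- t)"] exI[of _ "\<lambda>t. v'' (- t)"]) auto
  qed
  show "v t = u t"
    using wave_unique_nonneg[OF assms, of t]
      wave_unique_nonneg[OF reflect[OF assms(1)] reflect[OF assms(2)], of "- t"]
    by (cases "t \<ge> 0") auto
qed

section \<open>Existence for the abstract problems\<close>

text \<open>The symbols \<open>cos\<close>, \<open>- sin\<close>, \<open>- cos\<close> act on
  \<open>x\<close>, \<open>sqrtA x\<close>, \<open>A x\<close>. Signs are kept inside the symbols so
  that each derivative is itself a curve.\<close>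

lemma wave_solution_curve:
  assumes x: "x \<in> D"
  shows "wave_solution D A x (curve cos x)"
proof -
  have 0: "continuous_on UNIV (cos :: real \<Rightarrow> real)" "\<forall>s. \<bar>cos s\<bar> \<le> (1::real)"
    and 1: "continuous_on UNIV (\<lambda>s::real. - sin s)" "\<forall>s. \<bar>- sin s\<bar> \<le> (1::real)"
    and 2: "continuous_on UNIV (\<lambda>s::real. - cos s)" "\<forall>s. \<bar>- cos s\<bar> \<le> (1::real)"
    by (auto intro!: continuous_intros)
  have "(curve cos x has_vector_derivative curve (\<lambda>s. - sin s) (sqrtA x) t) (at t)" for t
    by (rule curve_has_vector_derivative[OF _ 0(2) 1 U_sqrtA[OF x]]) (auto intro!: derivative_eq_intros)
  moreover have "(curve (\<lambda>s. - sin s) (sqrtA x) has_vector_derivative curve (\<lambda>s. - cos s) (A x) t) (at t)" for t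
    by (rule curve_has_vector_derivative[OF _ 1(2) 2 U_A_sqrtA[OF x]]) (auto intro!: derivative_eq_intros)
  moreover have "curve (\<lambda>s. - cos s) (A x) t + curve cos (A x) t = 0" for t
  proof (rule eq_if_AE_eq)
    show "AE \<xi> in M. U (curve (\<lambda>s. - cos s) (A x) t + curve cos (A x) t) \<xi> = U 0 \<xi>"
      using U_curve[OF 0, of "A x" t] U_curve[OF 2, of "A x" t] U_zero
        U_add[of "curve (\<lambda>s. - cos s) (A x) t" "curve cos (A x) t"]
      by eventually_elim simp
  qed
  ultimately show ?thesis
    unfolding wave_solution_def
    using continuous_on_curve[OF 2, of UNIV "A x"] curve_in_D[OF 0 x] curve_0[OF 0] curve_0[OF 1]
    by (intro exI[of _ "curve (\<lambda>s. - sin s) (sqrtA x)"] exI[of _ "curve (\<lambda>s. - cos s) (A x)"]) auto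
qed

end

lemma bcos_symbols:
  assumes "lam > 0"
  shows "continuous_on UNIV (bcos lam k)" "continuous_on UNIV (\<lambda>s. - bcos lam k s)"
    "continuous_on UNIV (\<lambda>s. - bsin lam k s)" "\<forall>s. \<bar>bcos lam k s\<bar> \<le> 1"
    "\<forall>s. \<bar>- bcos lam k s\<bar> \<le> 1" "\<forall>s. \<bar>- bsin lam k s\<bar> \<le> 1"
proof -
  have "continuous_on UNIV (bcos lam k)" "continuous_on UNIV (bsin lam k)"
    using has_derivative_bcos_bsin[OF assms] by (auto intro!: DERIV_continuous_on)
  then show "continuous_on UNIV (bcos lam k)" "continuous_on UNIV (\<lambda>s. - bcos lam k s)"
    "continuous_on UNIV (\<lambda>s. - bsin lam k s)" by (auto intro: continuous_intros)
qed (use abs_bcos_bsin_le[OF assms] in auto)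

text \<open>This is \<open>bcos_ode\<close> at \<open>s = t * sqrt r\<close>, multiplied by
  \<open>sqrt r / t\<close>; each time derivative of the kernel has produced a factor
  \<open>sqrt r\<close>.\<close>

lemma bcos_ode_scaled:
  assumes "lam > 0" "t > 0" "r > 0"
  shows "- bcos lam 2 (t * sqrt r) * r + 2 * lam / t * (- bsin lam 1 (t * sqrt r) * sqrt r) +
    bcos lam 0 (t * sqrt r) * r = 0"
proof -
  have "2 * lam / t * (bsin lam 1 (t * sqrt r) * sqrt r) =
      (sqrt r / t) * (2 * lam * bsin lam 1 (t * sqrt r))" by simp
  also have "\<dots> = (sqrt r / t) * ((t * sqrt r) * (bcos lam 0 (t * sqrt r) - bcos lam 2 (t * sqrt r)))"
    using bcos_ode[OF assms(1), of "t * sqrt r"] by simp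
  also have "\<dots> = r * (bcos lam 0 (t * sqrt r) - bcos lam 2 (t * sqrt r))"
  proof -
    have "sqrt r / t * (t * sqrt r * y) = (sqrt r * sqrt r) * y" for y
      using assms by simp
    then show ?thesis using assms by simp
  qed
  finally show ?thesis by (simp add: algebra_simps)
qed

context diagonalization
begin

text \<open>The kernel and its first two derivatives act on \<open>x\<close>,
  \<open>sqrtA x\<close>, \<open>A x\<close>. At almost every \<open>\<xi>\<close> the equation
  reduces to \<open>bcos_ode_scaled\<close> with \<open>r = m \<xi>\<close>, and the initial
  velocity vanishes because \<open>bsin lam 1\<close> does at 0.\<close>

lemma epd_solution_curve:
  assumes lam: "lam > 0" and x: "x \<in> D"
  shows "epd_solution lam D A x (curve (bcos lam 0) x)"
proof -
  note sym0 = bcos_symbols(1,4)[OF lam, of 0]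
  note sym1 = bcos_symbols(3,6)[OF lam, of 1]
  note sym2 = bcos_symbols(2,5)[OF lam, of 2]
  let ?u' = "curve (\<lambda>s. - bsin lam 1 s) (sqrtA x)" and ?u'' = "curve (\<lambda>s. - bcos lam 2 s) (A x)"
  have d1: "(curve (bcos lam 0) x has_vector_derivative ?u' t) (at t)" for t
    by (rule curve_has_vector_derivative[OF _ sym0(2) sym1 U_sqrtA[OF x]])
       (use has_derivative_bcos_bsin(1)[OF lam, of 0] in simp)
  have d2: "(?u' has_vector_derivative ?u'' t) (at t)" for t
    by (rule curve_has_vector_derivative[OF _ sym1(2) sym2 U_A_sqrtA[OF x]])
       (use has_derivative_bcos_bsin(2)[OF lam, of 1] in \<open>auto simp: numeral_2_eq_2 intro!: derivative_eq_intros\<close>)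
  have ode: "?u'' t + (2 * lam / t) *\<^sub>R ?u' t + curve (bcos lam 0) (A x) t = 0" if "t > 0" for t
  proof (rule eq_if_AE_eq)
    show "AE \<xi> in M. U (?u'' t + (2 * lam / t) *\<^sub>R ?u' t + curve (bcos lam 0) (A x) t) \<xi> = U 0 \<xi>"
      using U_add[of "?u'' t + (2 * lam / t) *\<^sub>R ?u' t" "curve (bcos lam 0) (A x) t"]
        U_add[of "?u'' t" "(2 * lam / t) *\<^sub>R ?u' t"] U_scaleR[of "2 * lam / t" "?u' t"]
        U_curve[OF sym2, of "A x" t] U_curve[OF sym1, of "sqrtA x" t]
        U_curve[OF sym0, of "A x" t] U_A[OF x] U_sqrtA[OF x] U_zero AE_space
    proof eventually_elim
      case (elim \<xi>)
      let ?r = "m \<xi>"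
      have "U (?u'' t + (2 * lam / t) *\<^sub>R ?u' t + curve (bcos lam 0) (A x) t) \<xi> =
        complex_of_real (- bcos lam 2 (t * sqrt ?r) * ?r + 2 * lam / t * (- bsin lam 1 (t * sqrt ?r) * sqrt ?r) +
          bcos lam 0 (t * sqrt ?r) * ?r) * U x \<xi>"
        by (simp only: elim(1-8)) (simp add: algebra_simps)
      also have "\<dots> = 0"
        using bcos_ode_scaled[OF lam that m_pos[OF elim(10)]] by simp
      finally show ?case using elim by simp
    qed
  qed
  show ?thesis
    unfolding epd_solution_def
    using d1 d2 ode continuous_on_curve[OF sym1, of "{0..}" "sqrtA x"]
      continuous_on_curve[OF sym2, of "{0<..}" "A x"]
      curve_in_D[OF sym0 x] curve_0(1)[OF sym0] curve_0(2)[OF sym1] bcos_bsin_0[OF lam]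
    by (intro exI[of _ ?u'] exI[of _ ?u'']) (auto intro: has_vector_derivative_at_within)
qed

end

section \<open>The scalar problem and continuous versions\<close>

lemma scalar_epd_solution:
  assumes lam: "lam > 0" and r: "r > 0"
  shows "epd_solution lam UNIV (\<lambda>z. complex_of_real r * z) c
    (\<lambda>t. complex_of_real (bcos lam 0 (t * sqrt r)) * c)"
proof -
  interpret L: bounded_linear "\<lambda>x. complex_of_real x * c"
    by (intro bounded_linear_mult_const bounded_linear_of_real)
  have d1: "((\<lambda>t. complex_of_real (bcos lam 0 (t * sqrt r)) * c) has_vector_derivative
      complex_of_real (- bsin lam 1 (t * sqrt r) * sqrt r) * c) (at t)" for t
    by (rule L.has_vector_derivative, unfold has_real_derivative_iff_has_vector_derivative[symmetric],
        rule DERIV_chain2[OF has_derivative_bcos_bsin(1)[OF lam, of 0, unfolded One_nat_def[symmetric]]])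
       (auto intro!: derivative_eq_intros)
  have d2: "((\<lambda>t. complex_of_real (- bsin lam 1 (t * sqrt r) * sqrt r) * c) has_vector_derivative
      complex_of_real (- bcos lam 2 (t * sqrt r) * r) * c) (at t)" for t
  proof (rule L.has_vector_derivative, unfold has_real_derivative_iff_has_vector_derivative[symmetric])
    have "((\<lambda>t. bsin lam 1 (t * sqrt r)) has_real_derivative bcos lam 2 (t * sqrt r) * sqrt r) (at t)"
      unfolding numeral_2_eq_2 One_nat_def
      by (rule DERIV_chain2[OF has_derivative_bcos_bsin(2)[OF lam]]) (auto intro!: derivative_eq_intros)
    from DERIV_cmult_right[OF DERIV_minus[OF this], of "sqrt r"]
    show "((\<lambda>t. - bsin lam 1 (t * sqrt r) * sqrt r) has_real_derivative - bcos lam 2 (t * sqrt r) * r) (at t)"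
      using r by (simp add: mult.assoc)
  qed
  have cont: "continuous_on S (\<lambda>t. complex_of_real (- bsin lam 1 (t * sqrt r) * sqrt r) * c)"
    "continuous_on S (\<lambda>t. complex_of_real (- bcos lam 2 (t * sqrt r) * r) * c)" for S
  proof -
    note c1 = continuous_on_compose2[OF bcos_symbols(3)[OF lam, of 1], of S "\<lambda>t. t * sqrt r"]
    note c2 = continuous_on_compose2[OF bcos_symbols(2)[OF lam, of 2], of S "\<lambda>t. t * sqrt r"]
    show "continuous_on S (\<lambda>t. complex_of_real (- bsin lam 1 (t * sqrt r) * sqrt r) * c)"
      "continuous_on S (\<lambda>t. complex_of_real (- bcos lam 2 (t * sqrt r) * r) * c)"
      by (intro L.continuous_on continuous_on_mult_right c1 c2; auto intro!: continuous_intros)+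
  qed
  have ode: "complex_of_real (- bcos lam 2 (t * sqrt r) * r) * c +
      (2 * lam / t) *\<^sub>R (complex_of_real (- bsin lam 1 (t * sqrt r) * sqrt r) * c) +
      complex_of_real r * (complex_of_real (bcos lam 0 (t * sqrt r)) * c) = 0" if "t > 0" for t
  proof -
    have "complex_of_real (- bcos lam 2 (t * sqrt r) * r) * c +
        (2 * lam / t) *\<^sub>R (complex_of_real (- bsin lam 1 (t * sqrt r) * sqrt r) * c) +
        complex_of_real r * (complex_of_real (bcos lam 0 (t * sqrt r)) * c) =
        complex_of_real (- bcos lam 2 (t * sqrt r) * r + 2 * lam / t * (- bsin lam 1 (t * sqrt r) * sqrt r) +
          bcos lam 0 (t * sqrt r) * r) * c"
      by (simp add: scaleR_conv_of_real algebra_simps)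
    also have "\<dots> = 0" by (simp only: bcos_ode_scaled[OF lam that r]) simp
    finally show ?thesis .
  qed
  show ?thesis
    unfolding epd_solution_def
    by (intro exI[of _ "\<lambda>t. complex_of_real (- bsin lam 1 (t * sqrt r) * sqrt r) * c"]
        exI[of _ "\<lambda>t. complex_of_real (- bcos lam 2 (t * sqrt r) * r) * c"])
       (use d1 d2 cont ode bcos_bsin_0[OF lam] in \<open>auto intro: has_vector_derivative_at_within\<close>)
qed

text \<open>The energy estimate on the Hilbert space of complex numbers, where multiplication by
  \<open>r\<close> is already bounded, so no cutoff enters.\<close>

lemma scalar_epd_unique:
  fixes r :: real
  assumes "lam \<ge> 0" "r \<ge> 0"
    and "epd_solution lam UNIV (\<lambda>z. complex_of_real r * z) c v"
    and "epd_solution lam UNIV (\<lambda>z. complex_of_real r * z) c u" and "t \<ge> 0"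
  shows "v t = u t"
proof -
  obtain v' v'' where v: "\<forall>t\<ge>0. (v has_vector_derivative v' t) (at t within {0..})"
    "continuous_on {0..} v'" "\<forall>t>0. (v' has_vector_derivative v'' t) (at t)"
    "\<forall>t>0. v'' t + (2 * lam / t) *\<^sub>R v' t + complex_of_real r * v t = 0" "v 0 = c" "v' 0 = 0"
    using assms(3) unfolding epd_solution_def by blast
  obtain u' u'' where u: "\<forall>t\<ge>0. (u has_vector_derivative u' t) (at t within {0..})"
    "continuous_on {0..} u'" "\<forall>t>0. (u' has_vector_derivative u'' t) (at t)"
    "\<forall>t>0. u'' t + (2 * lam / t) *\<^sub>R u' t + complex_of_real r * u t = 0" "u 0 = c" "u' 0 = 0"
    using assms(4) unfolding epd_solution_def by blast
  have "v t - u t = 0"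
  proof (rule damped_wave_unique[where c = "2 * lam" and B = "\<lambda>z. complex_of_real r * z" and
        w = "\<lambda>t. v t - u t" and w' = "\<lambda>t. v' t - u' t" and w'' = "\<lambda>t. v'' t - u'' t"])
    show "bounded_linear (\<lambda>z. complex_of_real r * z)" by (rule bounded_linear_mult_right)
    show "rinner (complex_of_real r * x) y = rinner x (complex_of_real r * y)" for x y
      by (simp add: rinner_def cinner_complex_def algebra_simps)
    show "0 \<le> rinner (complex_of_real r * x) x" for x
    proof -
      have "rinner (complex_of_real r * x) x = r * rinner x x"
        by (simp add: rinner_def cinner_complex_def algebra_simps)
      then show ?thesis using assms(2) norm_sq_eq_rinner[of x, symmetric] by simp
    qed
    show "((\<lambda>t. v t - u t) has_vector_derivative v' t - u' t) (at t within {0..})" if "t \<ge> 0" for t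
      using u v that by (intro has_vector_derivative_diff) auto
    show "((\<lambda>t. v' t - u' t) has_vector_derivative v'' t - u'' t) (at t)" if "t > 0" for t
      using u v that by (intro has_vector_derivative_diff) auto
    show "continuous_on {0..} (\<lambda>t. v' t - u' t)"
      using u v by (intro continuous_on_diff)
    show "v'' t - u'' t + (2 * lam / t) *\<^sub>R (v' t - u' t) + complex_of_real r * (v t - u t) = 0"
      if "t > 0" for t
    proof -
      have "v'' t - u'' t + (2 * lam / t) *\<^sub>R (v' t - u' t) + complex_of_real r * (v t - u t) =
          (v'' t + (2 * lam / t) *\<^sub>R v' t + complex_of_real r * v t) -
          (u'' t + (2 * lam / t) *\<^sub>R u' t + complex_of_real r * u t)"
        by (simp add: scaleR_diff_right right_diff_distrib)
      then show ?thesis using u v that by simp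
    qed
  qed (use assms u v in auto)
  then show ?thesis by simp
qed

text \<open>A continuous version on \<open>{0..}\<close> says nothing about negative times, so
  solutions may be altered there.\<close>

lemma scalar_epd_cong:
  assumes "epd_solution lam UNIV B c v" "\<And>t. t \<ge> 0 \<Longrightarrow> u t = v t"
  shows "epd_solution lam UNIV B c u"
proof -
  obtain v' v'' where v: "\<forall>t\<ge>0. (v has_vector_derivative v' t) (at t within {0..})"
    "continuous_on {0..} v'" "\<forall>t>0. (v' has_vector_derivative v'' t) (at t)" "continuous_on {0<..} v''"
    "\<forall>t>0. v'' t + (2 * lam / t) *\<^sub>R v' t + B (v t) = 0" "v 0 = c" "v' 0 = 0"
    using assms(1) unfolding epd_solution_def by blast
  have "(u has_vector_derivative v' t) (at t within {0..})" if "t \<ge> 0" for t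
    by (rule has_vector_derivative_transform[of t "{0..}" u v]) (use that assms(2) v in auto)
  then show ?thesis
    unfolding epd_solution_def using v assms(2) by (intro exI[of _ v'] exI[of _ v'']) auto
qed

text \<open>Rational times approach \<open>t\<close> from the right, and upward closure of
  \<open>I\<close> keeps them in \<open>I\<close>. This covers both the half-line and the whole
  line.\<close>

lemma continuous_on_eq_if_rational:
  fixes a b :: "real \<Rightarrow> 'a::t2_space"
  assumes I: "\<And>t. t \<in> I \<Longrightarrow> {t..} \<subseteq> I" and "continuous_on I a" "continuous_on I b"
    and eq: "\<And>q. q \<in> I \<Longrightarrow> q \<in> \<rat> \<Longrightarrow> a q = b q" and t: "t \<in> I"
  shows "a t = b t"
proof -
  have "\<exists>q. q \<in> \<rat> \<and> t < q \<and> q < t + 1 / real (Suc n)" for n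
    using Rats_dense_in_real[of t "t + 1 / real (Suc n)"] by auto
  then obtain q where q: "\<And>n. q n \<in> \<rat>" "\<And>n. t < q n" "\<And>n. q n < t + 1 / real (Suc n)"
    by metis
  have "(\<lambda>n. t + 1 / real (Suc n)) \<longlonglongrightarrow> t + 0"
    by (intro tendsto_intros LIMSEQ_Suc[OF lim_1_over_n])
  then have lim: "q \<longlonglongrightarrow> t"
    by (intro tendsto_sandwich[of "\<lambda>_. t" q sequentially "\<lambda>n. t + 1 / real (Suc n)"]
        always_eventually allI less_imp_le q tendsto_const) simp
  have qI: "q n \<in> I" for n using I[OF t] q(2)[of n] by auto
  have "(\<lambda>n. a (q n)) \<longlonglongrightarrow> a t" "(\<lambda>n. b (q n)) \<longlonglongrightarrow> b t"
    using assms(2,3) lim t qI by (auto intro!: continuous_on_tendsto_compose[of I])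
  moreover have "a (q n) = b (q n)" for n using eq qI q(1) by blast
  ultimately show ?thesis by (simp add: LIMSEQ_unique)
qed

context diagonalization
begin

text \<open>A version agrees with the explicit kernel at each rational time outside a null set.
  Countably many null sets may be united, and continuity on both sides then extends the agreement to
  all of \<open>I\<close> with a null set independent of \<open>t\<close>.\<close>

lemma continuous_version_curve_iff:
  assumes I: "\<And>t. t \<in> I \<Longrightarrow> {t..} \<subseteq> I" and \<phi>: "continuous_on UNIV \<phi>" "\<forall>s. \<bar>\<phi> s\<bar> \<le> 1"
  shows "continuous_version M I (\<lambda>t. U (curve \<phi> x t)) h \<longleftrightarrow>
    (AE \<xi> in M. \<forall>t\<in>I. h t \<xi> = complex_of_real (\<phi> (t * sqrt (m \<xi>))) * U x \<xi>)"
proof -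
  have cont: "continuous_on I (\<lambda>t. complex_of_real (\<phi> (t * sqrt r)) * c)" for r c
    by (intro continuous_intros continuous_on_compose2[OF \<phi>(1)]) auto
  show ?thesis
  proof
    assume cv: "continuous_version M I (\<lambda>t. U (curve \<phi> x t)) h"
    have "AE \<xi> in M. h q \<xi> = complex_of_real (\<phi> (q * sqrt (m \<xi>))) * U x \<xi>" if "q \<in> I" for q
    proof -
      have "AE \<xi> in M. h q \<xi> = U (curve \<phi> x q) \<xi>"
        using cv that by (simp add: continuous_version_def)
      then show ?thesis using U_curve[OF \<phi>, of x q] by eventually_elim simp
    qed
    then have "AE \<xi> in M. \<forall>q\<in>I \<inter> \<rat>. h q \<xi> = complex_of_real (\<phi> (q * sqrt (m \<xi>))) * U x \<xi>"
      by (subst AE_ball_countable) (auto intro: countable_subset[OF _ countable_rat])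
    moreover have "AE \<xi> in M. continuous_on I (\<lambda>t. h t \<xi>)"
      using cv by (simp add: continuous_version_def)
    ultimately show "AE \<xi> in M. \<forall>t\<in>I. h t \<xi> = complex_of_real (\<phi> (t * sqrt (m \<xi>))) * U x \<xi>"
    proof eventually_elim
      case (elim \<xi>)
      show ?case
      proof
        fix t assume t: "t \<in> I"
        show "h t \<xi> = complex_of_real (\<phi> (t * sqrt (m \<xi>))) * U x \<xi>"
          by (rule continuous_on_eq_if_rational[OF I elim(2) cont _ t]) (use elim(1) in auto)
      qed
    qed
  next
    assume eq: "AE \<xi> in M. \<forall>t\<in>I. h t \<xi> = complex_of_real (\<phi> (t * sqrt (m \<xi>))) * U x \<xi>"
    have "AE \<xi> in M. continuous_on I (\<lambda>t. h t \<xi>)"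
      using eq
    proof eventually_elim
      case (elim \<xi>)
      then show ?case using cont[of "m \<xi>" "U x \<xi>"] by (simp cong: continuous_on_cong)
    qed
    moreover have "AE \<xi> in M. h t \<xi> = U (curve \<phi> x t) \<xi>" if "t \<in> I" for t
      using eq U_curve[OF \<phi>, of x t] by eventually_elim (use that in simp)
    ultimately show "continuous_version M I (\<lambda>t. U (curve \<phi> x t)) h"
      by (simp add: continuous_version_def)
  qed
qed

text \<open>By existence and uniqueness for the scalar problem, agreeing with the explicit kernel on
  nonnegative times and solving that problem are the same condition at each
  \<open>\<xi>\<close>.\<close>

lemma continuous_version_iff_scalar_epd:
  assumes "lam > 0"
  shows "continuous_version M {0..} (\<lambda>t. U (curve (bcos lam 0) x t)) h \<longleftrightarrow>
    (AE \<xi> in M. epd_solution lam UNIV (\<lambda>z. complex_of_real (m \<xi>) * z) (U x \<xi>) (\<lambda>t. h t \<xi>))"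
proof -
  have "(\<forall>t\<in>{0..}. h t \<xi> = complex_of_real (bcos lam 0 (t * sqrt (m \<xi>))) * U x \<xi>) \<longleftrightarrow>
      epd_solution lam UNIV (\<lambda>z. complex_of_real (m \<xi>) * z) (U x \<xi>) (\<lambda>t. h t \<xi>)"
    if \<xi>: "\<xi> \<in> space M" for \<xi>
  proof
    note sol = scalar_epd_solution[OF assms m_pos[OF \<xi>], of "U x \<xi>"]
    show "epd_solution lam UNIV (\<lambda>z. complex_of_real (m \<xi>) * z) (U x \<xi>) (\<lambda>t. h t \<xi>)"
      if "\<forall>t\<in>{0..}. h t \<xi> = complex_of_real (bcos lam 0 (t * sqrt (m \<xi>))) * U x \<xi>"
      by (rule scalar_epd_cong[OF sol]) (use that in blast)
    show "\<forall>t\<in>{0..}. h t \<xi> = complex_of_real (bcos lam 0 (t * sqrt (m \<xi>))) * U x \<xi>"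
      if h: "epd_solution lam UNIV (\<lambda>z. complex_of_real (m \<xi>) * z) (U x \<xi>) (\<lambda>t. h t \<xi>)"
    proof
      fix t :: real
      assume "t \<in> {0..}"
      then show "h t \<xi> = complex_of_real (bcos lam 0 (t * sqrt (m \<xi>))) * U x \<xi>"
        using scalar_epd_unique[OF less_imp_le[OF assms] less_imp_le[OF m_pos[OF \<xi>]] h sol, of t] by simp
    qed
  qed
  then have "(AE \<xi> in M. \<forall>t\<in>{0..}. h t \<xi> = complex_of_real (bcos lam 0 (t * sqrt (m \<xi>))) * U x \<xi>) \<longleftrightarrow>
      (AE \<xi> in M. epd_solution lam UNIV (\<lambda>z. complex_of_real (m \<xi>) * z) (U x \<xi>) (\<lambda>t. h t \<xi>))"
    by (intro AE_cong)
  then show ?thesis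
    by (subst continuous_version_curve_iff) (use bcos_symbols[OF assms, of 0] in auto)
qed

end

text \<open>One statement for both integrands of the theorem: the averaged exponentials with
  \<open>c = 1\<close> and the wave with \<open>c = U f \<xi>\<close>.\<close>

lemma poisson_integral:
  fixes c :: complex
  assumes "lam > 0" "t > 0"
    and h: "\<And>w. h w = complex_of_real (cos (r * w)) * c"
  shows "set_integrable lborel {- t..t} (\<lambda>w. complex_of_real ((1 - w\<^sup>2 / t\<^sup>2) powr (lam - 1)) * h w)"
    and "(LINT w:{- t..t}|lborel. complex_of_real ((1 - w\<^sup>2 / t\<^sup>2) powr (lam - 1)) * h w) =
      complex_of_real (Beta lam (1/2) * t * bcos lam 0 (t * r)) * c"
proof -
  have "has_bochner_integral lborel
      (\<lambda>w. complex_of_real (indicator {- t..t} w * ((1 - w\<^sup>2 / t\<^sup>2) powr (lam - 1) * cos (r * w))) * c)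
      (complex_of_real (Beta lam (1/2) * t * bcos lam 0 (t * r)) * c)"
    by (intro has_bochner_integral_mult_left has_bochner_integral_of_real has_bochner_integral_bcos assms)
  moreover have "(\<lambda>w. complex_of_real (indicator {- t..t} w * ((1 - w\<^sup>2 / t\<^sup>2) powr (lam - 1) * cos (r * w))) * c) =
      (\<lambda>w. indicator {- t..t} w *\<^sub>R (complex_of_real ((1 - w\<^sup>2 / t\<^sup>2) powr (lam - 1)) * h w))"
    by (auto simp: h indicator_def fun_eq_iff)
  ultimately have "has_bochner_integral lborel
      (\<lambda>w. indicator {- t..t} w *\<^sub>R (complex_of_real ((1 - w\<^sup>2 / t\<^sup>2) powr (lam - 1)) * h w))
      (complex_of_real (Beta lam (1/2) * t * bcos lam 0 (t * r)) * c)"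
    by (simp only:)
  then show "set_integrable lborel {- t..t} (\<lambda>w. complex_of_real ((1 - w\<^sup>2 / t\<^sup>2) powr (lam - 1)) * h w)"
    "(LINT w:{- t..t}|lborel. complex_of_real ((1 - w\<^sup>2 / t\<^sup>2) powr (lam - 1)) * h w) =
      complex_of_real (Beta lam (1/2) * t * bcos lam 0 (t * r)) * c"
    unfolding set_integrable_def set_lebesgue_integral_def has_bochner_integral_iff by blast+
qed

text \<open>The trailing factor 1 is the constant \<open>c\<close> in the hypothesis of
  \<open>poisson_integral\<close>.\<close>

lemma exp_sum_eq_cos:
  "(exp (\<i> * complex_of_real x) + exp (- \<i> * complex_of_real x)) / 2 = complex_of_real (cos x) * 1"
  using cos_exp_eq[of "complex_of_real x"] by (simp add: cos_of_real)

section \<open>The Bochner expectation\<close>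

text \<open>The sum runs over the values of \<open>q\<close>, not of \<open>g \<circ> q\<close>, so
  vector-valued and scalar functions of the same step function share one index set and one set of
  weights.\<close>

lemma (in finite_measure) simple_bochner_step:
  fixes g :: "'b \<Rightarrow> 'c::real_vector"
  assumes "simple_function M q"
  shows "Bochner_Integration.simple_bochner_integrable M (\<lambda>\<omega>. g (q \<omega>))"
    and "Bochner_Integration.simple_bochner_integral M (\<lambda>\<omega>. g (q \<omega>)) =
      (\<Sum>y\<in>q ` space M. measure M {\<omega> \<in> space M. q \<omega> = y} *\<^sub>R g y)"
proof -
  show *: "Bochner_Integration.simple_bochner_integrable M (\<lambda>\<omega>. g (q \<omega>))"
    by (intro Bochner_Integration.simple_bochner_integrable.intros
        simple_function_compose1[OF assms]) (simp add: emeasure_eq_measure)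
  show "Bochner_Integration.simple_bochner_integral M (\<lambda>\<omega>. g (q \<omega>)) =
      (\<Sum>y\<in>q ` space M. measure M {\<omega> \<in> space M. q \<omega> = y} *\<^sub>R g y)"
    by (rule Bochner_Integration.simple_bochner_integral_partition[OF * assms]) auto
qed

lemma abs_cos_diff_le: "\<bar>cos x - cos y\<bar> \<le> \<bar>x - y :: real\<bar>"
proof (cases "x = y")
  case False
  have "\<bar>(cos x - cos y) / (x - y)\<bar> \<le> 1"
    by (rule abs_difference_quotient_le[where \<phi>' = "\<lambda>s. - sin s"]) (auto intro!: derivative_eq_intros)
  with False show ?thesis by (simp add: abs_divide field_simps)
qed simp

context diagonalization
begin

text \<open>The wave is Lipschitz in time with constant \<open>norm (sqrtA x)\<close>, so uniform
  approximation of the random time approximates the wave uniformly.\<close>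

lemma norm_curve_cos_diff_le:
  assumes "x \<in> D"
  shows "norm (curve cos x a - curve cos x b) \<le> \<bar>a - b\<bar> * norm (sqrtA x)"
proof (rule norm_le)
  have cos: "continuous_on UNIV (cos :: real \<Rightarrow> real)" "\<forall>s. \<bar>cos s\<bar> \<le> (1::real)"
    by (auto intro!: continuous_intros)
  show "AE \<xi> in M. cmod (U (curve cos x a - curve cos x b) \<xi>) \<le> \<bar>a - b\<bar> * cmod (U (sqrtA x) \<xi>)"
    using U_diff[of "curve cos x a" "curve cos x b"] U_curve[OF cos, of x a] U_curve[OF cos, of x b]
      U_sqrtA[OF assms] AE_space
  proof eventually_elim
    case (elim \<xi>)
    have "U (curve cos x a - curve cos x b) \<xi> =
        complex_of_real (cos (a * sqrt (m \<xi>)) - cos (b * sqrt (m \<xi>))) * U x \<xi>"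
      by (simp only: elim(1-3)) (simp add: algebra_simps)
    then have "cmod (U (curve cos x a - curve cos x b) \<xi>) =
        \<bar>cos (a * sqrt (m \<xi>)) - cos (b * sqrt (m \<xi>))\<bar> * cmod (U x \<xi>)"
      by (simp only: norm_mult norm_of_real)
    also have "\<dots> \<le> \<bar>a * sqrt (m \<xi>) - b * sqrt (m \<xi>)\<bar> * cmod (U x \<xi>)"
      by (intro mult_right_mono abs_cos_diff_le) simp
    also have "\<dots> = \<bar>a - b\<bar> * cmod (U (sqrtA x) \<xi>)"
      using m_pos[OF elim(5)]
      by (simp add: elim(4) norm_mult abs_mult flip: left_diff_distrib)
    finally show ?case .
  qed
qed simp

text \<open>The measure \<open>M\<close> need not be \<open>\<sigma>\<close>-finite, so Fubini is avoided: step functions of the random time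
  are integrated by finite sums, to which \<open>U\<close> applies termwise.\<close>

lemma has_bochner_integral_gen_curve:
  assumes lam: "lam > 0" and x: "x \<in> D" and "prob_space P"
    and X: "distributed P lborel X (\<lambda>x. ennreal (beta_density (1/2) lam x))" and t: "t \<ge> 0"
  shows "has_bochner_integral_gen P (\<lambda>\<omega>. curve cos x (t * sqrt (X \<omega>))) (curve (bcos lam 0) x t)"
proof -
  interpret prob_space P by fact
  have cos: "continuous_on UNIV (cos :: real \<Rightarrow> real)" "\<forall>s. \<bar>cos s\<bar> \<le> (1::real)"
    by (auto intro!: continuous_intros)
  note bcos = bcos_symbols(1,4)[OF lam, of 0]
  have [measurable]: "X \<in> borel_measurable P"
    using distributed_measurable[OF X] by simp
  have X01: "AE \<omega> in P. 0 < X \<omega> \<and> X \<omega> < 1"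
    by (subst distributed_AE2[OF X]) (auto simp: beta_density_def)
  \<comment> \<open>Moves the kernel from the law on the line to the given probability
    space.\<close>
  have expect: "bcos lam 0 s = (LINT \<omega>|P. cos (s * sqrt (X \<omega>)))" for s
  proof -
    have "bcos lam 0 s = (LINT x|lborel. beta_density (1/2) lam x * cos (s * sqrt x))"
      unfolding bcos_def by (subst integral_beta_law(2)[OF lam]) simp_all
    also have "\<dots> = (LINT \<omega>|P. cos (s * sqrt (X \<omega>)))"
      by (rule distributed_integral[OF X]) (use lam in \<open>auto simp: beta_density_nonneg\<close>)
    finally show ?thesis .
  qed
  \<comment> \<open>Rounds the square root of \<open>X\<close> down to a multiple of
    \<open>1 / Suc i\<close>. Since \<open>X\<close> lies in the unit interval only almost surely,
    clamping is what makes the range finite everywhere.\<close>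
  define q where "q i \<omega> = of_int \<lfloor>real (Suc i) * min 1 (max 0 (sqrt (X \<omega>)))\<rfloor> / real (Suc i)" for i \<omega>
  have q_meas [measurable]: "q i \<in> borel_measurable P" for i
    unfolding q_def by measurable
  have q_simple: "simple_function P (q i)" for i
  proof (rule simple_function_borel_measurable[OF q_meas])
    have "q i ` space P \<subseteq> (\<lambda>k. of_int k / real (Suc i)) ` {0..int (Suc i)}"
    proof (rule image_subsetI)
      fix \<omega>
      let ?y = "real (Suc i) * min 1 (max 0 (sqrt (X \<omega>)))"
      have "0 \<le> ?y" by (intro mult_nonneg_nonneg) auto
      moreover have "?y \<le> real (Suc i) * 1" by (intro mult_left_mono) auto
      then have "\<lfloor>?y\<rfloor> \<le> \<lfloor>real (Suc i)\<rfloor>" by (intro floor_mono) simp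
      then have "\<lfloor>?y\<rfloor> \<le> int (Suc i)" by (simp only: floor_of_nat)
      ultimately have "\<lfloor>?y\<rfloor> \<in> {0..int (Suc i)}" by simp
      then show "q i \<omega> \<in> (\<lambda>k. of_int k / real (Suc i)) ` {0..int (Suc i)}"
        unfolding q_def by blast
    qed
    then show "finite (q i ` space P)" by (rule finite_subset) simp
  qed
  have q_close: "AE \<omega> in P. \<bar>q i \<omega> - sqrt (X \<omega>)\<bar> \<le> 1 / real (Suc i)" for i
    using X01
  proof eventually_elim
    case (elim \<omega>)
    then have y: "min 1 (max 0 (sqrt (X \<omega>))) = sqrt (X \<omega>)" by simp
    have "q i \<omega> - sqrt (X \<omega>) = (of_int \<lfloor>real (Suc i) * sqrt (X \<omega>)\<rfloor> - real (Suc i) * sqrt (X \<omega>)) / real (Suc i)"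
      unfolding q_def y by (simp add: diff_divide_distrib del: of_nat_Suc)
    moreover have "\<bar>of_int \<lfloor>real (Suc i) * sqrt (X \<omega>)\<rfloor> - real (Suc i) * sqrt (X \<omega>)\<bar> \<le> 1"
      by linarith
    ultimately show ?case
      by (simp add: abs_divide divide_right_mono del: of_nat_Suc)
  qed
  define s where "s i \<omega> = curve cos x (t * q i \<omega>)" for i \<omega>
  have "(\<lambda>i. t * (1 / real (Suc i)) * norm (sqrtA x)) \<longlonglongrightarrow> t * 0 * norm (sqrtA x)"
    by (intro tendsto_mult tendsto_const LIMSEQ_Suc[OF lim_1_over_n])
  then have to_0: "(\<lambda>i. t * (1 / real (Suc i)) * norm (sqrtA x)) \<longlonglongrightarrow> 0"
    by simp
  have s_close: "AE \<omega> in P. norm (curve cos x (t * sqrt (X \<omega>)) - s i \<omega>) \<le> t * (1 / real (Suc i)) * norm (sqrtA x)" for i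
    using q_close[of i]
  proof eventually_elim
    case (elim \<omega>)
    have "norm (curve cos x (t * sqrt (X \<omega>)) - s i \<omega>) \<le> \<bar>t * sqrt (X \<omega>) - t * q i \<omega>\<bar> * norm (sqrtA x)"
      unfolding s_def by (rule norm_curve_cos_diff_le[OF x])
    also have "\<bar>t * sqrt (X \<omega>) - t * q i \<omega>\<bar> = t * \<bar>q i \<omega> - sqrt (X \<omega>)\<bar>"
      using t by (simp add: abs_mult abs_minus_commute flip: right_diff_distrib)
    also have "t * \<bar>q i \<omega> - sqrt (X \<omega>)\<bar> * norm (sqrtA x) \<le> t * (1 / real (Suc i)) * norm (sqrtA x)"
      using elim t by (intro mult_right_mono mult_left_mono) auto
    finally show ?case .
  qed
  have "(\<lambda>\<omega>. curve cos x (t * sqrt (X \<omega>))) \<in> borel_measurable P"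
    by (rule measurable_compose[OF _ borel_measurable_continuous_onI[OF continuous_on_curve[OF cos]]]) simp
  moreover have "(\<lambda>i. \<integral>\<^sup>+\<omega>. norm (curve cos x (t * sqrt (X \<omega>)) - s i \<omega>) \<partial>P) \<longlonglongrightarrow> 0"
  proof (rule tendsto_sandwich[where f = "\<lambda>_. 0" and h = "\<lambda>i. ennreal (t * (1 / real (Suc i)) * norm (sqrtA x))"])
    show "\<forall>\<^sub>F i in sequentially. (\<integral>\<^sup>+\<omega>. norm (curve cos x (t * sqrt (X \<omega>)) - s i \<omega>) \<partial>P) \<le>
        ennreal (t * (1 / real (Suc i)) * norm (sqrtA x))"
    proof (intro always_eventually allI)
      fix i
      have "(\<integral>\<^sup>+\<omega>. norm (curve cos x (t * sqrt (X \<omega>)) - s i \<omega>) \<partial>P) \<le>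
          (\<integral>\<^sup>+\<omega>. ennreal (t * (1 / real (Suc i)) * norm (sqrtA x)) \<partial>P)"
        by (rule nn_integral_mono_AE) (use s_close[of i] in eventually_elim, rule ennreal_leI)
      then show "(\<integral>\<^sup>+\<omega>. norm (curve cos x (t * sqrt (X \<omega>)) - s i \<omega>) \<partial>P) \<le>
          ennreal (t * (1 / real (Suc i)) * norm (sqrtA x))"
        by (simp only: nn_integral_const emeasure_space_1 mult_1_right)
    qed
    show "(\<lambda>i. ennreal (t * (1 / real (Suc i)) * norm (sqrtA x))) \<longlonglongrightarrow> 0"
      using tendsto_ennrealI[OF to_0] by (simp only: ennreal_0)
  qed auto
  moreover have "(\<lambda>i. Bochner_Integration.simple_bochner_integral P (s i)) \<longlonglongrightarrow> curve (bcos lam 0) x t"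
  proof (rule LIM_zero_cancel, rule tendsto_norm_zero_cancel,
      rule tendsto_sandwich[where f = "\<lambda>_. 0" and h = "\<lambda>i. t * (1 / real (Suc i)) * norm (sqrtA x)"])
    show "\<forall>\<^sub>F i in sequentially.
        norm (Bochner_Integration.simple_bochner_integral P (s i) - curve (bcos lam 0) x t) \<le>
        t * (1 / real (Suc i)) * norm (sqrtA x)"
    \<comment> \<open>The integral of the step function is compared with its limit through
      representatives, with \<open>sqrtA x\<close> as the dominating vector.\<close>
    proof (rule always_eventually, rule allI, rule norm_le)
      fix i
      let ?I = "Bochner_Integration.simple_bochner_integral P (s i)"
      have fin: "finite (q i ` space P)" using q_simple[of i] by (simp add: simple_function_def)
      define p where "p y = prob {\<omega> \<in> space P. q i \<omega> = y}" for y
      have I: "?I = (\<Sum>y\<in>q i ` space P. p y *\<^sub>R curve cos x (t * y))"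
        unfolding s_def p_def by (rule simple_bochner_step(2)[OF q_simple])
      have "AE \<xi> in M. \<forall>y\<in>q i ` space P. U (p y *\<^sub>R curve cos x (t * y)) \<xi> =
          complex_of_real (p y * cos (t * y * sqrt (m \<xi>))) * U x \<xi>"
      proof (subst AE_ball_countable[OF countable_finite[OF fin]], intro ballI)
        fix y
        show "AE \<xi> in M. U (p y *\<^sub>R curve cos x (t * y)) \<xi> =
            complex_of_real (p y * cos (t * y * sqrt (m \<xi>))) * U x \<xi>"
          using U_scaleR[of "p y" "curve cos x (t * y)"] U_curve[OF cos, of x "t * y"]
          by eventually_elim simp
      qed
      then show "AE \<xi> in M. cmod (U (?I - curve (bcos lam 0) x t) \<xi>) \<le>
          t * (1 / real (Suc i)) * cmod (U (sqrtA x) \<xi>)"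
        using U_sum[OF fin, of "\<lambda>y. p y *\<^sub>R curve cos x (t * y)"] U_diff[of ?I "curve (bcos lam 0) x t"]
          U_curve[OF bcos, of x t] U_sqrtA[OF x] AE_space
      proof eventually_elim
        case (elim \<xi>)
        let ?r = "sqrt (m \<xi>)"
        have r: "?r > 0" using m_pos[OF elim(6)] by simp
        have int: "integrable P (\<lambda>\<omega>. cos (t * q i \<omega> * ?r))" "integrable P (\<lambda>\<omega>. cos (t * ?r * sqrt (X \<omega>)))"
          by (rule integrable_const_bound[where B = 1]; simp)+
        \<comment> \<open>At a fixed \<open>\<xi>\<close> the weighted finite sum is a scalar
          expectation, which can be compared with the formula \<open>expect\<close> for the
          kernel.\<close>
        have "(\<Sum>y\<in>q i ` space P. p y * cos (t * y * ?r)) = (LINT \<omega>|P. cos (t * q i \<omega> * ?r))"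
          using simple_bochner_step(2)[OF q_simple, of "\<lambda>y. cos (t * y * ?r)" i]
            Bochner_Integration.simple_bochner_integrable_eq_integral[OF
              simple_bochner_step(1)[OF q_simple, of "\<lambda>y. cos (t * y * ?r)" i]]
          by (simp add: p_def)
        moreover have "(\<Sum>y\<in>q i ` space P. U (p y *\<^sub>R curve cos x (t * y)) \<xi>) =
            (\<Sum>y\<in>q i ` space P. complex_of_real (p y * cos (t * y * ?r)) * U x \<xi>)"
          by (rule sum.cong[OF refl]) (use elim(1) in blast)
        ultimately have S: "(\<Sum>y\<in>q i ` space P. U (p y *\<^sub>R curve cos x (t * y)) \<xi>) =
            complex_of_real (LINT \<omega>|P. cos (t * q i \<omega> * ?r)) * U x \<xi>"
          by (simp only: sum_distrib_right[symmetric] of_real_sum[symmetric])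
        have "U (?I - curve (bcos lam 0) x t) \<xi> =
            complex_of_real ((LINT \<omega>|P. cos (t * q i \<omega> * ?r)) - bcos lam 0 (t * ?r)) * U x \<xi>"
          unfolding elim(3,4) unfolding I elim(2) S by (simp add: left_diff_distrib)
        also have "(LINT \<omega>|P. cos (t * q i \<omega> * ?r)) - bcos lam 0 (t * ?r) =
            (LINT \<omega>|P. cos (t * q i \<omega> * ?r) - cos (t * ?r * sqrt (X \<omega>)))"
          unfolding expect using int by simp
        finally have eq: "cmod (U (?I - curve (bcos lam 0) x t) \<xi>) =
            \<bar>LINT \<omega>|P. cos (t * q i \<omega> * ?r) - cos (t * ?r * sqrt (X \<omega>))\<bar> * cmod (U x \<xi>)"
          by (simp only: norm_mult norm_of_real)
        have "AE \<omega> in P. \<bar>cos (t * q i \<omega> * ?r) - cos (t * ?r * sqrt (X \<omega>))\<bar> \<le> t * (1 / real (Suc i)) * ?r"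
          using q_close[of i]
        proof eventually_elim
          case (elim \<omega>)
          have "\<bar>cos (t * q i \<omega> * ?r) - cos (t * ?r * sqrt (X \<omega>))\<bar> \<le> \<bar>t * q i \<omega> * ?r - t * ?r * sqrt (X \<omega>)\<bar>"
            by (rule abs_cos_diff_le)
          also have "t * q i \<omega> * ?r - t * ?r * sqrt (X \<omega>) = t * (q i \<omega> - sqrt (X \<omega>)) * ?r"
            by (simp add: algebra_simps)
          also have "\<bar>\<dots>\<bar> = t * \<bar>q i \<omega> - sqrt (X \<omega>)\<bar> * ?r"
            using t r by (simp add: abs_mult)
          also have "\<dots> \<le> t * (1 / real (Suc i)) * ?r"
            using elim t r by (intro mult_right_mono mult_left_mono) auto
          finally show ?case .
        qed
        then have "(LINT \<omega>|P. \<bar>cos (t * q i \<omega> * ?r) - cos (t * ?r * sqrt (X \<omega>))\<bar>) \<le> t * (1 / real (Suc i)) * ?r"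
          by (intro integral_le_const integrable_abs Bochner_Integration.integrable_diff int)
        then have "\<bar>LINT \<omega>|P. cos (t * q i \<omega> * ?r) - cos (t * ?r * sqrt (X \<omega>))\<bar> \<le> t * (1 / real (Suc i)) * ?r"
          by (rule order_trans[OF integral_abs_bound])
        then have "cmod (U (?I - curve (bcos lam 0) x t) \<xi>) \<le> t * (1 / real (Suc i)) * ?r * cmod (U x \<xi>)"
          unfolding eq by (rule mult_right_mono) simp
        also have "\<dots> = t * (1 / real (Suc i)) * cmod (U (sqrtA x) \<xi>)"
          using r by (simp add: elim(5) norm_mult)
        finally show ?case .
      qed
    qed (use t in simp)
  qed (use to_0 in auto)
  moreover have "Bochner_Integration.simple_bochner_integrable P (s i)" for i
    unfolding s_def by (rule simple_bochner_step(1)[OF q_simple])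
  ultimately show ?thesis
    unfolding has_bochner_integral_gen_def by blast
qed

end

section \<open>The representations and the random-time formula\<close>

theorem theorem4:
  fixes lam :: real
    and D :: "'h::complex_hilbert_space set" and A :: "'h \<Rightarrow> 'h" and f :: 'h
    and M :: "'w measure" and U :: "'h \<Rightarrow> 'w \<Rightarrow> complex" and m :: "'w \<Rightarrow> real"
    and P :: "'p measure" and X :: "'p \<Rightarrow> real"
  assumes lam: "lam > 0"
    and self_adjoint: "self_adjoint D A"
    and positive: "positive_operator D A"
    and injective: "inj_on A D"
    and f: "f \<in> D"
    and U: "unitary_onto_L2 M U"
    and m_meas: "m \<in> borel_measurable M"
    and m_pos: "\<And>\<xi>. \<xi> \<in> space M \<Longrightarrow> m \<xi> > 0"
    and diag: "conjugate_to_multiplication M U m D A"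
    and P: "prob_space P"
    and X: "distributed P lborel X (\<lambda>x. ennreal (beta_density (1/2) lam x))"
  shows "\<exists>u ubar.
    epd_solution lam D A f u \<and> (\<forall>v. epd_solution lam D A f v \<longrightarrow> (\<forall>t\<ge>0. v t = u t)) \<and>
    wave_solution D A f ubar \<and> (\<forall>v. wave_solution D A f v \<longrightarrow> v = ubar) \<and>
    (\<exists>uhat. continuous_version M {0..} (\<lambda>t. U (u t)) uhat) \<and>
    (\<exists>ubarhat. continuous_version M UNIV (\<lambda>w. U (ubar w)) ubarhat) \<and>
    (\<forall>uhat. continuous_version M {0..} (\<lambda>t. U (u t)) uhat \<longleftrightarrow>
      (AE \<xi> in M. epd_solution lam UNIV (\<lambda>z. complex_of_real (m \<xi>) * z) (U f \<xi>) (\<lambda>t. uhat t \<xi>))) \<and>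
    (\<forall>uhat ubarhat.
      continuous_version M {0..} (\<lambda>t. U (u t)) uhat \<longrightarrow>
      continuous_version M UNIV (\<lambda>w. U (ubar w)) ubarhat \<longrightarrow>
      (AE \<xi> in M. \<forall>t>0.
        uhat t \<xi> =
          complex_of_real ((2 / (t * sqrt (m \<xi>))) powr (lam - 1/2) * Gamma (lam + 1/2) *
            bessel_J (lam - 1/2) (t * sqrt (m \<xi>))) * U f \<xi> \<and>
        set_integrable lborel {-t..t} (\<lambda>w. complex_of_real ((1 - w\<^sup>2 / t\<^sup>2) powr (lam - 1)) *
          ((exp (\<i> * complex_of_real (sqrt (m \<xi>) * w)) +
            exp (- \<i> * complex_of_real (sqrt (m \<xi>) * w))) / 2)) \<and>
        uhat t \<xi> =
          U f \<xi> / complex_of_real (Beta lam (1/2) * t) *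
            (LINT w:{-t..t}|lborel. complex_of_real ((1 - w\<^sup>2 / t\<^sup>2) powr (lam - 1)) *
              ((exp (\<i> * complex_of_real (sqrt (m \<xi>) * w)) +
                exp (- \<i> * complex_of_real (sqrt (m \<xi>) * w))) / 2)) \<and>
        set_integrable lborel {-t..t} (\<lambda>w. complex_of_real ((1 - w\<^sup>2 / t\<^sup>2) powr (lam - 1)) *
          ubarhat w \<xi>) \<and>
        uhat t \<xi> =
          1 / complex_of_real (Beta lam (1/2) * t) *
            (LINT w:{-t..t}|lborel. complex_of_real ((1 - w\<^sup>2 / t\<^sup>2) powr (lam - 1)) *
              ubarhat w \<xi>))) \<and>
    (\<forall>t\<ge>0. has_bochner_integral_gen P (\<lambda>\<omega>. ubar (t * sqrt (X \<omega>))) (u t))"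
proof -
  interpret diagonalization M U m D A
    by standard (use U m_meas m_pos diag in auto)
  define u where "u = curve (bcos lam 0) f"
  define ubar where "ubar = curve cos f"
  have cos: "continuous_on UNIV (cos :: real \<Rightarrow> real)" "\<forall>s. \<bar>cos s\<bar> \<le> (1::real)"
    by (auto intro!: continuous_intros)
  note bcos = bcos_symbols(1,4)[OF lam, of 0]
  have u_iff: "continuous_version M {0..} (\<lambda>t. U (u t)) h \<longleftrightarrow>
      (AE \<xi> in M. \<forall>t\<in>{0..}. h t \<xi> = complex_of_real (bcos lam 0 (t * sqrt (m \<xi>))) * U f \<xi>)" for h
    unfolding u_def by (rule continuous_version_curve_iff[OF _ bcos]) auto
  have ubar_iff: "continuous_version M UNIV (\<lambda>w. U (ubar w)) h \<longleftrightarrow>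
      (AE \<xi> in M. \<forall>w\<in>UNIV. h w \<xi> = complex_of_real (cos (w * sqrt (m \<xi>))) * U f \<xi>)" for h
    unfolding ubar_def by (rule continuous_version_curve_iff[OF _ cos]) auto
  have epd: "epd_solution lam D A f u" unfolding u_def by (rule epd_solution_curve[OF lam f])
  have wave: "wave_solution D A f ubar" unfolding ubar_def by (rule wave_solution_curve[OF f])
  show ?thesis
  proof (rule exI[of _ u], rule exI[of _ ubar], intro conjI allI impI)
    show "v t = u t" if "epd_solution lam D A f v" "t \<ge> 0" for v t
      using epd_unique[OF _ that(1) epd that(2)] lam by simp
    show "v = ubar" if "wave_solution D A f v" for v
      by (rule wave_unique[OF that wave])
    show "\<exists>uhat. continuous_version M {0..} (\<lambda>t. U (u t)) uhat"
      \<comment> \<open>Unification with \<open>refl\<close> makes the explicit kernel times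
        \<open>U f \<xi>\<close> the witness.\<close>
      unfolding u_iff by (intro exI AE_I2 ballI) (rule refl)
    show "\<exists>ubarhat. continuous_version M UNIV (\<lambda>w. U (ubar w)) ubarhat"
      unfolding ubar_iff by (intro exI AE_I2 ballI) (rule refl)
    show "continuous_version M {0..} (\<lambda>t. U (u t)) uhat \<longleftrightarrow>
        (AE \<xi> in M. epd_solution lam UNIV (\<lambda>z. complex_of_real (m \<xi>) * z) (U f \<xi>) (\<lambda>t. uhat t \<xi>))" for uhat
      unfolding u_def by (rule continuous_version_iff_scalar_epd[OF lam])
    show "has_bochner_integral_gen P (\<lambda>\<omega>. ubar (t * sqrt (X \<omega>))) (u t)" if "t \<ge> 0" for t
      unfolding u_def ubar_def by (rule has_bochner_integral_gen_curve[OF lam f P X that])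
    fix uhat ubarhat
    assume uhat: "continuous_version M {0..} (\<lambda>t. U (u t)) uhat"
      and ubarhat: "continuous_version M UNIV (\<lambda>w. U (ubar w)) ubarhat"
    show "AE \<xi> in M. \<forall>t>0.
        uhat t \<xi> =
          complex_of_real ((2 / (t * sqrt (m \<xi>))) powr (lam - 1/2) * Gamma (lam + 1/2) *
            bessel_J (lam - 1/2) (t * sqrt (m \<xi>))) * U f \<xi> \<and>
        set_integrable lborel {-t..t} (\<lambda>w. complex_of_real ((1 - w\<^sup>2 / t\<^sup>2) powr (lam - 1)) *
          ((exp (\<i> * complex_of_real (sqrt (m \<xi>) * w)) +
            exp (- \<i> * complex_of_real (sqrt (m \<xi>) * w))) / 2)) \<and>
        uhat t \<xi> =
          U f \<xi> / complex_of_real (Beta lam (1/2) * t) *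
            (LINT w:{-t..t}|lborel. complex_of_real ((1 - w\<^sup>2 / t\<^sup>2) powr (lam - 1)) *
              ((exp (\<i> * complex_of_real (sqrt (m \<xi>) * w)) +
                exp (- \<i> * complex_of_real (sqrt (m \<xi>) * w))) / 2)) \<and>
        set_integrable lborel {-t..t} (\<lambda>w. complex_of_real ((1 - w\<^sup>2 / t\<^sup>2) powr (lam - 1)) *
          ubarhat w \<xi>) \<and>
        uhat t \<xi> =
          1 / complex_of_real (Beta lam (1/2) * t) *
            (LINT w:{-t..t}|lborel. complex_of_real ((1 - w\<^sup>2 / t\<^sup>2) powr (lam - 1)) *
              ubarhat w \<xi>)"
      using uhat[unfolded u_iff] ubarhat[unfolded ubar_iff] AE_space
    proof eventually_elim
      case (elim \<xi>)
      let ?r = "sqrt (m \<xi>)"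
      have r: "?r > 0" using m_pos[OF elim(3)] by simp
      show ?case
      proof (intro allI impI)
        fix t :: real
        assume t: "t > 0"
        have ut: "uhat t \<xi> = complex_of_real (bcos lam 0 (t * ?r)) * U f \<xi>"
          using elim(1) t by simp
        have nz: "Beta lam (1/2) * t \<noteq> 0" using Beta_pos[OF lam, of "1/2"] t by simp
        \<comment> \<open>Two shapes are needed because \<open>U f \<xi>\<close> stands outside the
          integral of the exponentials but inside that of the wave.\<close>
        have cancel: "c / complex_of_real b * (complex_of_real (b * y) * 1) = complex_of_real y * c"
          "1 / complex_of_real b * (complex_of_real (b * y) * c) = complex_of_real y * c"
          if "b \<noteq> 0" for b y c using that by simp_all
        have exp_eq: "(exp (\<i> * complex_of_real (?r * w)) + exp (- \<i> * complex_of_real (?r * w))) / 2 =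
            complex_of_real (cos (?r * w)) * 1" for w
          by (rule exp_sum_eq_cos)
        have bar_eq: "ubarhat w \<xi> = complex_of_real (cos (?r * w)) * U f \<xi>" for w
          using elim(2) unfolding mult.commute[of ?r] by blast
        note exp_int = poisson_integral[OF lam t exp_eq]
        note bar_int = poisson_integral[OF lam t bar_eq]
        show "uhat t \<xi> =
          complex_of_real ((2 / (t * sqrt (m \<xi>))) powr (lam - 1/2) * Gamma (lam + 1/2) *
            bessel_J (lam - 1/2) (t * sqrt (m \<xi>))) * U f \<xi> \<and>
        set_integrable lborel {-t..t} (\<lambda>w. complex_of_real ((1 - w\<^sup>2 / t\<^sup>2) powr (lam - 1)) *
          ((exp (\<i> * complex_of_real (sqrt (m \<xi>) * w)) +
            exp (- \<i> * complex_of_real (sqrt (m \<xi>) * w))) / 2)) \<and>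
        uhat t \<xi> =
          U f \<xi> / complex_of_real (Beta lam (1/2) * t) *
            (LINT w:{-t..t}|lborel. complex_of_real ((1 - w\<^sup>2 / t\<^sup>2) powr (lam - 1)) *
              ((exp (\<i> * complex_of_real (sqrt (m \<xi>) * w)) +
                exp (- \<i> * complex_of_real (sqrt (m \<xi>) * w))) / 2)) \<and>
        set_integrable lborel {-t..t} (\<lambda>w. complex_of_real ((1 - w\<^sup>2 / t\<^sup>2) powr (lam - 1)) *
          ubarhat w \<xi>) \<and>
        uhat t \<xi> =
          1 / complex_of_real (Beta lam (1/2) * t) *
            (LINT w:{-t..t}|lborel. complex_of_real ((1 - w\<^sup>2 / t\<^sup>2) powr (lam - 1)) *
              ubarhat w \<xi>)"
          unfolding exp_int(2) bar_int(2)
        proof (intro conjI)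
          show "uhat t \<xi> = complex_of_real ((2 / (t * ?r)) powr (lam - 1/2) * Gamma (lam + 1/2) *
              bessel_J (lam - 1/2) (t * ?r)) * U f \<xi>"
            unfolding bcos_eq_bessel_J[OF lam mult_pos_pos[OF t r], symmetric] by (rule ut)
          show "uhat t \<xi> = U f \<xi> / complex_of_real (Beta lam (1/2) * t) *
              (complex_of_real (Beta lam (1/2) * t * bcos lam 0 (t * ?r)) * 1)"
            "uhat t \<xi> = 1 / complex_of_real (Beta lam (1/2) * t) *
              (complex_of_real (Beta lam (1/2) * t * bcos lam 0 (t * ?r)) * U f \<xi>)"
            unfolding ut cancel[OF nz] by (rule refl)+
        qed (rule exp_int(1) bar_int(1))+
      qed
    qed
  qed (rule epd wave)+
qed

end
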